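(* Let $\mathbb{K}$ be a field and let $p,q,\lambda,\mu\in\mathbb{K}^{\ast}$. Assume that neither $p$ nor $q$ is a root of unity. Let $\varphi$ be a $\mathbb{K}$-algebra automorphism of $\mathcal{A}_p(\lambda,\mu,\mathbb{K}_q[s,t])$. Then $$\varphi(x)=\alpha x,\quad \varphi(y)=\alpha^{-1}y,\quad \varphi(s)=\beta s,\quad \varphi(t)=\gamma t$$ for some $\alpha,\beta,\gamma\in\mathbb{K}^{\ast}$.
   Context: For a field $\mathbb{K}$ and $p,q,\lambda,\mu\in\mathbb{K}^{\ast}$, $\mathcal{A}_p(\lambda,\mu,\mathbb{K}_q[s,t])$ denotes the associative unital $\mathbb{K}$-algebra generated by $x,y,s,t$ subject to the relations $$xy-pyx=1,\quad st=qts,\quad sx=\lambda xs,\quad sy=\lambda^{-1}ys,\quad tx=\mu xt,\quad ty=\mu^{-1}yt.$$ The number $1$ counts as a root of unity. *)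

theory Defs
  imports "HOL-Algebra.Algebra" "HOL-Algebra.Algebraic_Closure_Type" "HOL-Library.Poly_Mapping"
begin

section \<open>Associative unital algebras given by generators and relations\<close>

text \<open>The free monoid on the type of generators, written additively as \<^typ>\<open>'a \<Rightarrow>\<^sub>0 'b\<close> expects
  an additive monoid of exponents; its operation is concatenation and is not commutative.\<close>

datatype 'g free_monoid = Wrd (letters: "'g list")

instantiation free_monoid :: (type) monoid_add
begin

definition zero_free_monoid :: "'a free_monoid" where
  "0 = Wrd []"

definition plus_free_monoid :: "'a free_monoid \<Rightarrow> 'a free_monoid \<Rightarrow> 'a free_monoid" where
  "u + v = Wrd (letters u @ letters v)"

instance
proof
  fix a b c :: "'a free_monoid"
  show "a + b + c = a + (b + c)" by (simp add: plus_free_monoid_def)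
  show "0 + a = a" by (cases a) (simp add: plus_free_monoid_def zero_free_monoid_def)
  show "a + 0 = a" by (cases a) (simp add: plus_free_monoid_def zero_free_monoid_def)
qed

end

text \<open>The free algebra is the monoid algebra of the free monoid: finitely supported functions
  with the convolution product.\<close>

type_synonym ('k, 'g) free_alg = "'g free_monoid \<Rightarrow>\<^sub>0 'k"

definition gen :: "'g \<Rightarrow> ('k::field, 'g) free_alg" where
  "gen g = Poly_Mapping.single (Wrd [g]) 1"

definition scalar :: "'k::field \<Rightarrow> ('k, 'g) free_alg" where
  "scalar c = Poly_Mapping.single 0 c"

abbreviation free_alg_ring :: "('k::field, 'g) free_alg ring" where
  "free_alg_ring \<equiv> ring_of_type_algebra"

lemma ring_free_alg: "ring (free_alg_ring :: ('k::field, 'g) free_alg ring)"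
proof -
  have "\<exists>y. x + y = 0" for x :: "('k, 'g) free_alg"
    using add.right_inverse by blast
  then show ?thesis
    unfolding ring_of_type_algebra_def using add.right_inverse
    by unfold_locales (auto simp: algebra_simps Units_def)
qed

text \<open>The relations are given as a set of relators, a relation \<open>a = b\<close> being encoded by
  \<open>a - b\<close>. In HOL-Algebra ideals are two-sided, so \<open>genideal\<close> (written \<open>Idl\<close>) is the two-sided
  ideal generated by the relators.\<close>

definition relation_ideal :: "('k::field, 'g) free_alg set \<Rightarrow> ('k, 'g) free_alg set" where
  "relation_ideal R = genideal free_alg_ring R"

definition residue_class :: "('k::field, 'g) free_alg set \<Rightarrow> ('k, 'g) free_alg \<Rightarrow> ('k, 'g) free_alg set" where
  "residue_class R a = a_r_coset free_alg_ring (relation_ideal R) a"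

definition presented_algebra ::
  "('k::field, 'g) free_alg set \<Rightarrow> ('k, ('k, 'g) free_alg set) module" where
  "presented_algebra R =
     (let Q = free_alg_ring Quot relation_ideal R
      in ring.extend Q (module.fields (\<lambda>c a. residue_class R (scalar c) \<otimes>\<^bsub>Q\<^esub> a)))"

definition algebra_automorphism :: "('k::field, 'a) module \<Rightarrow> ('a \<Rightarrow> 'a) \<Rightarrow> bool" where
  "algebra_automorphism A \<phi> \<longleftrightarrow>
     \<phi> \<in> ring_iso A A \<and> (\<forall>c. \<forall>a \<in> carrier A. \<phi> (c \<odot>\<^bsub>A\<^esub> a) = c \<odot>\<^bsub>A\<^esub> \<phi> a)"

section \<open>The algebra $\mathcal{A}_p(\lambda,\mu,\mathbb{K}_q[s,t])$\<close>

datatype generator = Gx | Gy | Gs | Gt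

definition relators ::
  "'k::field \<Rightarrow> 'k \<Rightarrow> 'k \<Rightarrow> 'k \<Rightarrow> ('k, generator) free_alg set" where
  "relators p lam mu q =
    {gen Gx * gen Gy - scalar p * gen Gy * gen Gx - 1,
     gen Gs * gen Gt - scalar q * gen Gt * gen Gs,
     gen Gs * gen Gx - scalar lam * gen Gx * gen Gs,
     gen Gs * gen Gy - scalar (inverse lam) * gen Gy * gen Gs,
     gen Gt * gen Gx - scalar mu * gen Gx * gen Gt,
     gen Gt * gen Gy - scalar (inverse mu) * gen Gy * gen Gt}"

definition alg_A ::
  "'k::field \<Rightarrow> 'k \<Rightarrow> 'k \<Rightarrow> 'k \<Rightarrow> ('k, ('k, generator) free_alg set) module" where
  "alg_A p lam mu q = presented_algebra (relators p lam mu q)"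

definition A_gen ::
  "'k::field \<Rightarrow> 'k \<Rightarrow> 'k \<Rightarrow> 'k \<Rightarrow> generator \<Rightarrow> ('k, generator) free_alg set" where
  "A_gen p lam mu q g = residue_class (relators p lam mu q) (gen g)"

definition root_of_unity :: "'k::field \<Rightarrow> bool" where
  "root_of_unity z \<longleftrightarrow> (\<exists>n::nat. n > 0 \<and> z ^ n = 1)"

section \<open>Basic facts\<close>

lemma ideal_relation_ideal: "ideal (relation_ideal R) free_alg_ring"
  unfolding relation_ideal_def
  by (rule ring.genideal_ideal[OF ring_free_alg]) (simp add: ring_of_type_algebra_def)

lemma presented_algebra_simps:
  fixes R :: "('k::field, 'g) free_alg set"
  shows
  "carrier (presented_algebra R) = range (residue_class R)"
  "\<one>\<^bsub>presented_algebra R\<^esub> = residue_class R 1"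
  "\<zero>\<^bsub>presented_algebra R\<^esub> = residue_class R 0"
  "residue_class R a \<oplus>\<^bsub>presented_algebra R\<^esub> residue_class R b = residue_class R (a + b)"
  "residue_class R a \<otimes>\<^bsub>presented_algebra R\<^esub> residue_class R b = residue_class R (a * b)"
  "c \<odot>\<^bsub>presented_algebra R\<^esub> residue_class R a = residue_class R (scalar c * a)"
proof -
  interpret I: ideal "relation_ideal R" free_alg_ring by (rule ideal_relation_ideal)
  have F: "carrier free_alg_ring = (UNIV :: ('k, 'g) free_alg set)"
    "\<one>\<^bsub>free_alg_ring\<^esub> = (1 :: ('k, 'g) free_alg)" "\<zero>\<^bsub>free_alg_ring\<^esub> = (0 :: ('k, 'g) free_alg)"
    "\<And>a b :: ('k, 'g) free_alg. a \<oplus>\<^bsub>free_alg_ring\<^esub> b = a + b"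
    "\<And>a b :: ('k, 'g) free_alg. a \<otimes>\<^bsub>free_alg_ring\<^esub> b = a * b"
    by (simp_all add: ring_of_type_algebra_def)
  note P = presented_algebra_def Let_def residue_class_def ring.extend_def module.fields_def FactRing_simps F
  show "carrier (presented_algebra R) = range (residue_class R)"
    by (auto simp: presented_algebra_def Let_def residue_class_def ring.extend_def module.fields_def
        FactRing_def A_RCOSETS_def' a_r_coset_def' F)
  show "\<one>\<^bsub>presented_algebra R\<^esub> = residue_class R 1"
    by (simp add: P)
  show "\<zero>\<^bsub>presented_algebra R\<^esub> = residue_class R 0"
    using I.a_coset_add_zero[OF I.a_subset] by (simp add: P)
  show "residue_class R a \<oplus>\<^bsub>presented_algebra R\<^esub> residue_class R b = residue_class R (a + b)"
    using I.a_rcos_sum[of a b] by (simp add: P)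
  show "residue_class R a \<otimes>\<^bsub>presented_algebra R\<^esub> residue_class R b = residue_class R (a * b)"
    using I.rcoset_mult_add[of a b] by (simp add: P)
  show "c \<odot>\<^bsub>presented_algebra R\<^esub> residue_class R a = residue_class R (scalar c * a)"
    using I.rcoset_mult_add[of "scalar c" a] by (simp add: P)
qed

lemma residue_class_eq_iff: "residue_class R a = residue_class R b \<longleftrightarrow> a - b \<in> relation_ideal R"
proof -
  have "a \<ominus>\<^bsub>free_alg_ring\<^esub> b = a - b"
    using abelian_group.minus_equality[OF ring.is_abelian_group[OF ring_free_alg], of "- b" b]
    by (simp add: a_minus_def ring_of_type_algebra_def)
  then show ?thesis
    using ring.quotient_eq_iff_same_a_r_cos[OF ring_free_alg ideal_relation_ideal, of a b R]
    by (simp add: residue_class_def ring_of_type_algebra_def)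
qed

lemma A_relations:
  fixes p q lam mu :: "'k::field"
  defines "A \<equiv> alg_A p lam mu q" and "x \<equiv> A_gen p lam mu q Gx" and "y \<equiv> A_gen p lam mu q Gy"
    and "s \<equiv> A_gen p lam mu q Gs" and "t \<equiv> A_gen p lam mu q Gt"
  shows "x \<otimes>\<^bsub>A\<^esub> y = p \<odot>\<^bsub>A\<^esub> (y \<otimes>\<^bsub>A\<^esub> x) \<oplus>\<^bsub>A\<^esub> \<one>\<^bsub>A\<^esub>"
    "s \<otimes>\<^bsub>A\<^esub> t = q \<odot>\<^bsub>A\<^esub> (t \<otimes>\<^bsub>A\<^esub> s)"
    "s \<otimes>\<^bsub>A\<^esub> x = lam \<odot>\<^bsub>A\<^esub> (x \<otimes>\<^bsub>A\<^esub> s)"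
    "s \<otimes>\<^bsub>A\<^esub> y = inverse lam \<odot>\<^bsub>A\<^esub> (y \<otimes>\<^bsub>A\<^esub> s)"
    "t \<otimes>\<^bsub>A\<^esub> x = mu \<odot>\<^bsub>A\<^esub> (x \<otimes>\<^bsub>A\<^esub> t)"
    "t \<otimes>\<^bsub>A\<^esub> y = inverse mu \<odot>\<^bsub>A\<^esub> (y \<otimes>\<^bsub>A\<^esub> t)"
proof -
  have "relators p lam mu q \<subseteq> relation_ideal (relators p lam mu q)"
    unfolding relation_ideal_def
    by (rule ring.genideal_self[OF ring_free_alg]) (simp add: ring_of_type_algebra_def)
  then have *: "r \<in> relators p lam mu q \<Longrightarrow> r \<in> relation_ideal (relators p lam mu q)" for r
    by blast
  note D = A_def x_def y_def s_def t_def alg_A_def A_gen_def presented_algebra_simps residue_class_eq_iff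
  show "x \<otimes>\<^bsub>A\<^esub> y = p \<odot>\<^bsub>A\<^esub> (y \<otimes>\<^bsub>A\<^esub> x) \<oplus>\<^bsub>A\<^esub> \<one>\<^bsub>A\<^esub>"
    "s \<otimes>\<^bsub>A\<^esub> t = q \<odot>\<^bsub>A\<^esub> (t \<otimes>\<^bsub>A\<^esub> s)"
    "s \<otimes>\<^bsub>A\<^esub> x = lam \<odot>\<^bsub>A\<^esub> (x \<otimes>\<^bsub>A\<^esub> s)"
    "s \<otimes>\<^bsub>A\<^esub> y = inverse lam \<odot>\<^bsub>A\<^esub> (y \<otimes>\<^bsub>A\<^esub> s)"
    "t \<otimes>\<^bsub>A\<^esub> x = mu \<odot>\<^bsub>A\<^esub> (x \<otimes>\<^bsub>A\<^esub> t)"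
    "t \<otimes>\<^bsub>A\<^esub> y = inverse mu \<odot>\<^bsub>A\<^esub> (y \<otimes>\<^bsub>A\<^esub> t)"
    unfolding D by (rule *, simp add: relators_def mult.assoc diff_diff_eq)+
qed

end

theory Submission
  imports Defs
begin

text \<open>The element \<open>z = xy - yx = 1 + (p - 1) yx\<close> satisfies \<open>xz = p zx\<close> and \<open>zy = p yz\<close> and commutes with
\<open>s\<close> and \<open>t\<close>. So \<open>z\<close>, \<open>s\<close> and \<open>t\<close> are normal elements, that is, elements \<open>u\<close> with
\<open>A u = u A\<close>. The point of the proof is that the nonzero normal elements are exactly the monomials
\<open>c z^i s^k t^l\<close> (lemma \<open>normal_imp_monomial\<close>). An automorphism permutes the normal elements, hence
it induces an automorphism of the monoid of exponents \<open>(i, k, l)\<close> and permutes its three irreducible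
elements (lemma \<open>normal_generators_permuted\<close>). Among \<open>z\<close>, \<open>s\<close>, \<open>t\<close> only the ordered pair
\<open>(s, t)\<close> satisfies \<open>st = q ts\<close>, so each of the three is fixed up to a scalar. Then
\<open>xz = p zx\<close> makes the image of \<open>x\<close> homogeneous of degree 1, and the factorization of
\<open>z - 1 = (p - 1) yx\<close> leaves only \<open>x \<mapsto> \<alpha> x\<close> and \<open>y \<mapsto> \<alpha>^-1 y\<close> (lemma \<open>x_y_fixed\<close>).

For the computations the algebra is embedded into the quantum torus with generators \<open>z\<close>, \<open>x\<close>, \<open>s\<close>,
\<open>t\<close> by \<open>y \<mapsto> (z - 1) x^-1 / (p - 1)\<close>. There \<open>z\<close>, \<open>x\<close>, \<open>s\<close>, \<open>t\<close> are monomials, and the product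
is that of a group algebra of \<open>\<int>^4\<close> twisted by a bicharacter. A linear order on \<open>\<int>^4\<close> makes highest and
lowest exponents additive, so that a conjugate of a monomial is a multiple of the same monomial (lemma
\<open>conjugate_monomial\<close>). The embedding is faithful because the images of the spanning elements
\<open>y^i x^j s^k t^l\<close> have distinct leading exponents (lemma \<open>in_relation_ideal_if_ev_zero\<close>). The
image is not all of the torus. Two constraints on it are used: the exponents of \<open>z\<close>, \<open>s\<close>,
\<open>t\<close> are nonnegative, and coefficients of negative powers of \<open>x\<close> are divisible by \<open>z - 1\<close>
(lemmas \<open>model_nonneg\<close> and \<open>model_layer_sum\<close>). The second one rules out powers of \<open>x\<close> and \<open>y\<close> as
normal elements and normalizes the scalar of \<open>z\<close> to 1.\<close>

section \<open>Twisted group algebras of ordered groups\<close>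

lemma poly_mapping_linear_induct [case_names zero single add]:
  fixes f :: "'a \<Rightarrow>\<^sub>0 'b::comm_monoid_add"
  assumes "P 0" and "\<And>k v. P (Poly_Mapping.single k v)" and "\<And>f g. P f \<Longrightarrow> P g \<Longrightarrow> P (f + g)"
  shows "P f"
proof (induction f rule: update_induct)
  case (update f a b)
  then have "Poly_Mapping.update a b f = f + Poly_Mapping.single a b"
    by (intro poly_mapping_eqI) (auto simp: lookup_update lookup_add lookup_single in_keys_iff when_def)
  with update assms show ?case by metis
qed (rule assms)

lemma add_eq_add_of_le:
  fixes a b u v :: "'w::linordered_ab_group_add"
  assumes "u \<le> a" "v \<le> b" "u + v = a + b"
  shows "u = a \<and> v = b"
  using add_less_le_mono[of u a v b] add_le_less_mono[of u a v b] assms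
  by (auto simp: order.order_iff_strict)

lemma single_nonzero: "c \<noteq> 0 \<Longrightarrow> Poly_Mapping.single u c \<noteq> 0"
  by (metis lookup_single_eq lookup_zero)

text \<open>A bicharacter \<open>\<sigma>\<close> is in particular a 2-cocycle, which is what makes the product
\<open>m_u \<star> m_v = \<sigma>(u, v) m_(u+v)\<close> on finitely supported functions associative. The linear order on the
exponent group makes this algebra a domain: extreme exponents add under multiplication.\<close>

locale twisted_group_algebra =
  fixes \<sigma> :: "'w::linordered_ab_group_add \<Rightarrow> 'w \<Rightarrow> 'k::field"
  assumes bichar_nonzero: "\<sigma> u v \<noteq> 0"
    and bichar_add_left: "\<sigma> (u + v) w = \<sigma> u w * \<sigma> v w"
    and bichar_add_right: "\<sigma> u (v + w) = \<sigma> u v * \<sigma> u w"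
begin

lemma bichar_zero_left [simp]: "\<sigma> 0 v = 1"
  using bichar_add_left[of 0 0 v] bichar_nonzero[of 0 v] by simp

lemma bichar_zero_right [simp]: "\<sigma> v 0 = 1"
  using bichar_add_right[of v 0 0] bichar_nonzero[of v 0] by simp

definition tmult :: "('w \<Rightarrow>\<^sub>0 'k) \<Rightarrow> ('w \<Rightarrow>\<^sub>0 'k) \<Rightarrow> ('w \<Rightarrow>\<^sub>0 'k)"  (infixl "\<star>" 70) where
  "f \<star> g = (\<Sum>u\<in>Poly_Mapping.keys f. \<Sum>v\<in>Poly_Mapping.keys g.
     Poly_Mapping.single (u + v) (\<sigma> u v * Poly_Mapping.lookup f u * Poly_Mapping.lookup g v))"

lemma tmult_superset:
  assumes "finite U" "Poly_Mapping.keys f \<subseteq> U" "finite V" "Poly_Mapping.keys g \<subseteq> V"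
  shows "f \<star> g = (\<Sum>u\<in>U. \<Sum>v\<in>V.
    Poly_Mapping.single (u + v) (\<sigma> u v * Poly_Mapping.lookup f u * Poly_Mapping.lookup g v))"
proof -
  have "f \<star> g = (\<Sum>u\<in>Poly_Mapping.keys f. \<Sum>v\<in>V.
    Poly_Mapping.single (u + v) (\<sigma> u v * Poly_Mapping.lookup f u * Poly_Mapping.lookup g v))"
    unfolding tmult_def using assms
    by (intro sum.cong sum.mono_neutral_left) (auto simp: in_keys_iff)
  also have "\<dots> = (\<Sum>u\<in>U. \<Sum>v\<in>V.
    Poly_Mapping.single (u + v) (\<sigma> u v * Poly_Mapping.lookup f u * Poly_Mapping.lookup g v))"
    using assms by (intro sum.mono_neutral_left) (auto simp: in_keys_iff)
  finally show ?thesis .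
qed

lemma tmult_add_left: "(f + g) \<star> h = f \<star> h + g \<star> h"
proof -
  let ?U = "Poly_Mapping.keys f \<union> Poly_Mapping.keys g" and ?V = "Poly_Mapping.keys h"
  have "finite ?U" "finite ?V" "Poly_Mapping.keys (f + g) \<subseteq> ?U"
    "Poly_Mapping.keys f \<subseteq> ?U" "Poly_Mapping.keys g \<subseteq> ?U"
    using Poly_Mapping.keys_add[of f g] by auto
  then show ?thesis
    by (simp add: tmult_superset[of ?U _ ?V] lookup_add algebra_simps single_add sum.distrib)
qed

lemma tmult_add_right: "h \<star> (f + g) = h \<star> f + h \<star> g"
proof -
  let ?U = "Poly_Mapping.keys f \<union> Poly_Mapping.keys g" and ?V = "Poly_Mapping.keys h"
  have "finite ?U" "finite ?V" "Poly_Mapping.keys (f + g) \<subseteq> ?U"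
    "Poly_Mapping.keys f \<subseteq> ?U" "Poly_Mapping.keys g \<subseteq> ?U"
    using Poly_Mapping.keys_add[of f g] by auto
  then show ?thesis
    by (simp add: tmult_superset[of ?V _ ?U] lookup_add algebra_simps single_add sum.distrib)
qed

lemma tmult_single: "Poly_Mapping.single u a \<star> Poly_Mapping.single v b = Poly_Mapping.single (u + v) (\<sigma> u v * a * b)"
  by (subst tmult_superset[of "{u}" _ "{v}"]) auto

lemma tmult_zero [simp]: "0 \<star> f = 0" "f \<star> 0 = 0"
  by (simp_all add: tmult_def)

lemma tmult_minus: "(- f) \<star> g = - (f \<star> g)" "f \<star> (- g) = - (f \<star> g)"
  using tmult_add_left[of "- f" f g] tmult_add_right[of f "- g" g] by (simp_all add: eq_neg_iff_add_eq_0)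

lemma tmult_diff: "(f - g) \<star> h = f \<star> h - g \<star> h" "h \<star> (f - g) = h \<star> f - h \<star> g"
  using tmult_add_left[of f "- g" h] tmult_add_right[of h f "- g"] by (simp_all add: tmult_minus)

lemma tmult_assoc: "(f \<star> g) \<star> h = f \<star> (g \<star> h)"
proof (induction f rule: poly_mapping_linear_induct)
  case (single u a)
  show ?case
  proof (induction g rule: poly_mapping_linear_induct)
    case (single v b)
    show ?case
      by (induction h rule: poly_mapping_linear_induct)
        (simp_all add: tmult_single bichar_add_left bichar_add_right algebra_simps tmult_add_right)
  qed (simp_all add: tmult_add_left tmult_add_right)
qed (simp_all add: tmult_add_left)

lemma one_tmult [simp]: "1 \<star> f = f" and tmult_one [simp]: "f \<star> 1 = f"
proof -
  have "Poly_Mapping.single 0 1 \<star> f = f" "f \<star> Poly_Mapping.single 0 1 = f"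
    by (induction f rule: poly_mapping_linear_induct)
      (simp_all add: tmult_add_right tmult_add_left tmult_single del: single_one)
  then show "1 \<star> f = f" "f \<star> 1 = f" by simp_all
qed

lemma lookup_single_tmult:
  "Poly_Mapping.lookup (Poly_Mapping.single u a \<star> f) w = \<sigma> u (w - u) * a * Poly_Mapping.lookup f (w - u)"
  by (induction f rule: poly_mapping_linear_induct)
    (auto simp: tmult_single tmult_add_right lookup_add lookup_single when_def algebra_simps)

lemma lookup_tmult_single:
  "Poly_Mapping.lookup (f \<star> Poly_Mapping.single v b) w = \<sigma> (w - v) v * b * Poly_Mapping.lookup f (w - v)"
  by (induction f rule: poly_mapping_linear_induct)
    (auto simp: tmult_single tmult_add_left lookup_add lookup_single when_def algebra_simps)

lemma scalar_central: "f \<star> Poly_Mapping.single 0 c = Poly_Mapping.single 0 c \<star> f"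
  by (rule poly_mapping_eqI) (simp add: lookup_single_tmult lookup_tmult_single)

lemma scalar_tmult_commute: "f \<star> (Poly_Mapping.single 0 c \<star> g) = Poly_Mapping.single 0 c \<star> (f \<star> g)"
  by (metis scalar_central tmult_assoc)

lemma scalar_scalar: "Poly_Mapping.single 0 a \<star> (Poly_Mapping.single 0 b \<star> f) = Poly_Mapping.single 0 (a * b) \<star> f"
  by (simp add: tmult_assoc[symmetric] tmult_single)

lemma scalar_tmult_scalar:
  "(Poly_Mapping.single 0 a \<star> f) \<star> (Poly_Mapping.single 0 b \<star> g) = Poly_Mapping.single 0 (a * b) \<star> (f \<star> g)"
  by (metis scalar_tmult_commute scalar_scalar tmult_assoc)

lemma lookup_tmult:
  "Poly_Mapping.lookup (f \<star> g) w = (\<Sum>(u, v) | u \<in> Poly_Mapping.keys f \<and> v \<in> Poly_Mapping.keys g \<and> u + v = w.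
     \<sigma> u v * Poly_Mapping.lookup f u * Poly_Mapping.lookup g v)"
proof -
  have "Poly_Mapping.lookup (f \<star> g) w = (\<Sum>(u, v) \<in> Poly_Mapping.keys f \<times> Poly_Mapping.keys g.
     \<sigma> u v * Poly_Mapping.lookup f u * Poly_Mapping.lookup g v when u + v = w)"
    by (simp add: tmult_def lookup_sum lookup_single sum.cartesian_product case_prod_unfold)
  also have "\<dots> = (\<Sum>(u, v) | u \<in> Poly_Mapping.keys f \<and> v \<in> Poly_Mapping.keys g \<and> u + v = w.
     \<sigma> u v * Poly_Mapping.lookup f u * Poly_Mapping.lookup g v)"
    by (intro sum.mono_neutral_cong_right) (auto simp: when_def split: if_splits)
  finally show ?thesis .
qed

text \<open>If an exponent is a sum of exponents of \<open>f\<close> and \<open>g\<close> in one way only, there is no cancellation at it.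
The extreme exponents below are of this kind.\<close>

lemma lookup_tmult_unique:
  assumes "\<And>u v. u \<in> Poly_Mapping.keys f \<Longrightarrow> v \<in> Poly_Mapping.keys g \<Longrightarrow> u + v = u0 + v0 \<Longrightarrow> u = u0 \<and> v = v0"
    and "u0 \<in> Poly_Mapping.keys f" "v0 \<in> Poly_Mapping.keys g"
  shows "Poly_Mapping.lookup (f \<star> g) (u0 + v0) = \<sigma> u0 v0 * Poly_Mapping.lookup f u0 * Poly_Mapping.lookup g v0"
proof -
  have "{(u, v). u \<in> Poly_Mapping.keys f \<and> v \<in> Poly_Mapping.keys g \<and> u + v = u0 + v0} = {(u0, v0)}"
    using assms by auto
  then show ?thesis by (simp add: lookup_tmult)
qed

lemma keys_tmult_subset:
  "w \<in> Poly_Mapping.keys (f \<star> g) \<Longrightarrow> \<exists>u\<in>Poly_Mapping.keys f. \<exists>v\<in>Poly_Mapping.keys g. w = u + v"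
proof -
  assume "w \<in> Poly_Mapping.keys (f \<star> g)"
  then have "(\<Sum>(u, v) | u \<in> Poly_Mapping.keys f \<and> v \<in> Poly_Mapping.keys g \<and> u + v = w.
     \<sigma> u v * Poly_Mapping.lookup f u * Poly_Mapping.lookup g v) \<noteq> 0"
    by (simp only: in_keys_iff lookup_tmult not_False_eq_True)
  then show ?thesis
    by (auto elim!: sum.not_neutral_contains_not_neutral)
qed

definition top_exp :: "('w \<Rightarrow>\<^sub>0 'k) \<Rightarrow> 'w" where
  "top_exp f = Max (Poly_Mapping.keys f)"

definition bot_exp :: "('w \<Rightarrow>\<^sub>0 'k) \<Rightarrow> 'w" where
  "bot_exp f = Min (Poly_Mapping.keys f)"

lemma top_exp_in: "f \<noteq> 0 \<Longrightarrow> top_exp f \<in> Poly_Mapping.keys f"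
  and top_exp_ge: "u \<in> Poly_Mapping.keys f \<Longrightarrow> u \<le> top_exp f"
  and bot_exp_in: "f \<noteq> 0 \<Longrightarrow> bot_exp f \<in> Poly_Mapping.keys f"
  and bot_exp_le: "u \<in> Poly_Mapping.keys f \<Longrightarrow> bot_exp f \<le> u"
  by (simp_all add: top_exp_def bot_exp_def)

lemma top_exp_eqI: "w \<in> Poly_Mapping.keys f \<Longrightarrow> (\<And>u. u \<in> Poly_Mapping.keys f \<Longrightarrow> u \<le> w) \<Longrightarrow> top_exp f = w"
  and bot_exp_eqI: "w \<in> Poly_Mapping.keys f \<Longrightarrow> (\<And>u. u \<in> Poly_Mapping.keys f \<Longrightarrow> w \<le> u) \<Longrightarrow> bot_exp f = w"
  by (auto simp: top_exp_def bot_exp_def intro!: Max_eqI Min_eqI)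

lemma top_exp_tmult:
  assumes "f \<noteq> 0" "g \<noteq> 0"
  shows "top_exp (f \<star> g) = top_exp f + top_exp g" and "f \<star> g \<noteq> 0"
proof -
  have "u = top_exp f \<and> v = top_exp g"
    if "u \<in> Poly_Mapping.keys f" "v \<in> Poly_Mapping.keys g" "u + v = top_exp f + top_exp g" for u v
    using add_eq_add_of_le[OF top_exp_ge[OF that(1)] top_exp_ge[OF that(2)] that(3)] .
  from lookup_tmult_unique[OF this top_exp_in[OF assms(1)] top_exp_in[OF assms(2)]]
  have "Poly_Mapping.lookup (f \<star> g) (top_exp f + top_exp g) \<noteq> 0"
    using top_exp_in[OF assms(1)] top_exp_in[OF assms(2)] bichar_nonzero
    by (metis in_keys_iff mult_eq_0_iff)
  then have *: "top_exp f + top_exp g \<in> Poly_Mapping.keys (f \<star> g)"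
    by (simp only: in_keys_iff not_False_eq_True)
  then show "f \<star> g \<noteq> 0" by auto
  show "top_exp (f \<star> g) = top_exp f + top_exp g"
  proof (rule top_exp_eqI[OF *])
    fix w assume "w \<in> Poly_Mapping.keys (f \<star> g)"
    then obtain u v where "u \<in> Poly_Mapping.keys f" "v \<in> Poly_Mapping.keys g" "w = u + v"
      using keys_tmult_subset by blast
    then show "w \<le> top_exp f + top_exp g"
      using add_mono[OF top_exp_ge top_exp_ge] by blast
  qed
qed

lemma bot_exp_tmult:
  assumes "f \<noteq> 0" "g \<noteq> 0"
  shows "bot_exp (f \<star> g) = bot_exp f + bot_exp g"
proof -
  have "u = bot_exp f \<and> v = bot_exp g"
    if "u \<in> Poly_Mapping.keys f" "v \<in> Poly_Mapping.keys g" "u + v = bot_exp f + bot_exp g" for u v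
    using bot_exp_le[OF that(1)] bot_exp_le[OF that(2)] that(3)
      add_eq_add_of_le[of "bot_exp f" u "bot_exp g" v] by simp
  from lookup_tmult_unique[OF this bot_exp_in[OF assms(1)] bot_exp_in[OF assms(2)]]
  have "Poly_Mapping.lookup (f \<star> g) (bot_exp f + bot_exp g) \<noteq> 0"
    using bot_exp_in[OF assms(1)] bot_exp_in[OF assms(2)] bichar_nonzero
    by (metis in_keys_iff mult_eq_0_iff)
  then have *: "bot_exp f + bot_exp g \<in> Poly_Mapping.keys (f \<star> g)"
    by (simp only: in_keys_iff not_False_eq_True)
  show "bot_exp (f \<star> g) = bot_exp f + bot_exp g"
  proof (rule bot_exp_eqI[OF *])
    fix w assume "w \<in> Poly_Mapping.keys (f \<star> g)"
    then obtain u v where "u \<in> Poly_Mapping.keys f" "v \<in> Poly_Mapping.keys g" "w = u + v"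
      using keys_tmult_subset by blast
    then show "bot_exp f + bot_exp g \<le> w"
      using add_mono[OF bot_exp_le bot_exp_le] by blast
  qed
qed

lemma monomial_of_top_eq_bot:
  assumes "f \<noteq> 0" "top_exp f = bot_exp f"
  shows "f = Poly_Mapping.single (bot_exp f) (Poly_Mapping.lookup f (bot_exp f))"
proof -
  have "u = bot_exp f" if "u \<in> Poly_Mapping.keys f" for u
    using top_exp_ge[OF that] bot_exp_le[OF that] assms by simp
  then show ?thesis
    by (intro poly_mapping_eqI) (auto simp: lookup_single when_def in_keys_iff)
qed

lemma top_bot_single [simp]:
  "c \<noteq> 0 \<Longrightarrow> top_exp (Poly_Mapping.single u c) = u" "c \<noteq> 0 \<Longrightarrow> bot_exp (Poly_Mapping.single u c) = u"
  by (simp_all add: top_exp_def bot_exp_def)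

lemma top_exp_one [simp]: "top_exp 1 = 0"
  by (simp add: top_exp_def)

lemma tmult_left_cancel: "f \<noteq> 0 \<Longrightarrow> f \<star> g = f \<star> h \<Longrightarrow> g = h"
  using top_exp_tmult(2)[of f "g - h"] by (auto simp: tmult_diff)

lemma tmult_right_cancel: "f \<noteq> 0 \<Longrightarrow> g \<star> f = h \<star> f \<Longrightarrow> g = h"
  using top_exp_tmult(2)[of "g - h" f] by (auto simp: tmult_diff)

text \<open>Comparing highest and lowest exponents on both sides shows that the conjugate \<open>g\<close> of a monomial has
its highest and its lowest exponent equal to \<open>e\<close>. The comparison of coefficients then says that all
exponents of \<open>u\<close> have the same commutation factor with \<open>e\<close>.\<close>

lemma conjugate_monomial:
  assumes "c \<noteq> 0" "u \<noteq> 0" "Poly_Mapping.single e c \<star> u = u \<star> g"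
  obtains d where "d \<noteq> 0" "g = Poly_Mapping.single e d"
    "\<And>v. v \<in> Poly_Mapping.keys u \<Longrightarrow> c * \<sigma> e v = d * \<sigma> v e"
proof -
  let ?m = "Poly_Mapping.single e c"
  have m: "?m \<noteq> 0" using assms(1) by (rule single_nonzero)
  have g: "g \<noteq> 0" using top_exp_tmult(2)[OF m assms(2)] assms(3) by auto
  have "top_exp g = e" "bot_exp g = e"
    using top_exp_tmult(1)[OF m assms(2)] top_exp_tmult(1)[OF assms(2) g]
      bot_exp_tmult[OF m assms(2)] bot_exp_tmult[OF assms(2) g] assms by (simp_all add: algebra_simps)
  with monomial_of_top_eq_bot[OF g] have g': "g = Poly_Mapping.single e (Poly_Mapping.lookup g e)" by simp
  define d where "d = Poly_Mapping.lookup g e"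
  have "c * \<sigma> e v = d * \<sigma> v e" if "v \<in> Poly_Mapping.keys u" for v
  proof -
    have "Poly_Mapping.lookup (?m \<star> u) (e + v) = Poly_Mapping.lookup (u \<star> Poly_Mapping.single e d) (e + v)"
      using assms(3) g' d_def by simp
    then have "c * \<sigma> e v * Poly_Mapping.lookup u v = d * \<sigma> v e * Poly_Mapping.lookup u v"
      by (simp add: lookup_single_tmult lookup_tmult_single algebra_simps)
    with that show ?thesis by (simp add: in_keys_iff)
  qed
  moreover have "d \<noteq> 0" using g g' d_def by auto
  ultimately show ?thesis using that g' d_def by blast
qed

end

section \<open>The quantum torus that contains the algebra\<close>

text \<open>The exponent \<open>Expo b d k l\<close> stands for the normally ordered monomial \<open>z^b x^d s^k t^l\<close>, where
\<open>z = xy - yx = 1 + (p - 1) yx\<close>.\<close>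

datatype expo = Expo (ez: int) (ex: int) (es: int) (et: int)

lemma expo_eq_iff: "u = v \<longleftrightarrow> ez u = ez v \<and> ex u = ex v \<and> es u = es v \<and> et u = et v"
  by (cases u; cases v) auto

instantiation expo :: linordered_ab_group_add
begin

definition "0 = Expo 0 0 0 0"
definition "u + v = Expo (ez u + ez v) (ex u + ex v) (es u + es v) (et u + et v)"
definition "u - v = Expo (ez u - ez v) (ex u - ex v) (es u - es v) (et u - et v)"
definition "- u = Expo (- ez u) (- ex u) (- es u) (- et u)"

text \<open>The lexicographic order in which \<open>z\<close> comes last, so that the exponent of \<open>z\<close> is the least positive
one. This is used to analyse factorizations of \<open>z - c\<close>, whose two exponents are adjacent.\<close>

definition "u < v \<longleftrightarrow> es u < es v \<or> es u = es v \<and> (et u < et v \<or> et u = et v \<and>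
  (ex u < ex v \<or> ex u = ex v \<and> ez u < ez v))"
definition "u \<le> (v :: expo) \<longleftrightarrow> u < v \<or> u = v"

instance
proof
  fix x y :: expo
  show "x \<le> y \<or> y \<le> x"
    using expo_eq_iff[of x y] by (simp only: less_eq_expo_def less_expo_def) linarith
qed (auto simp: zero_expo_def plus_expo_def minus_expo_def uminus_expo_def
    less_expo_def less_eq_expo_def)

end

lemma expo_simps [simp]:
  "ez 0 = 0" "ex 0 = 0" "es 0 = 0" "et 0 = 0"
  "ez (u + v) = ez u + ez v" "ex (u + v) = ex u + ex v"
  "es (u + v) = es u + es v" "et (u + v) = et u + et v"
  "ez (u - v) = ez u - ez v" "ex (u - v) = ex u - ex v"
  "es (u - v) = es u - es v" "et (u - v) = et u - et v"
  "ez (- u) = - ez u" "ex (- u) = - ex u" "es (- u) = - es u" "et (- u) = - et u"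
  by (simp_all add: zero_expo_def plus_expo_def minus_expo_def uminus_expo_def)

abbreviation "eZ \<equiv> Expo 1 0 0 0"
abbreviation "eX \<equiv> Expo 0 1 0 0"
abbreviation "eS \<equiv> Expo 0 0 1 0"
abbreviation "eT \<equiv> Expo 0 0 0 1"

lemma power_int_eq_1_imp:
  assumes "\<not> root_of_unity (a :: 'k::field)" "a \<noteq> 0" "a powi n = 1"
  shows "n = 0"
proof (rule ccontr)
  assume "n \<noteq> 0"
  then have "nat \<bar>n\<bar> > 0" by simp
  moreover have "a ^ nat \<bar>n\<bar> = 1"
    using assms(3) by (auto simp: power_int_def power_inverse abs_if split: if_splits)
  ultimately show False using assms(1) unfolding root_of_unity_def by blast
qed

lemma power_int_inject:
  assumes "\<not> root_of_unity (a :: 'k::field)" "a \<noteq> 0" "a powi m = a powi n"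
  shows "m = n"
  using power_int_eq_1_imp[OF assms(1,2), of "m - n"] assms(2,3) by (simp add: power_int_diff)

locale alg_parameters =
  fixes p q lam mu :: "'k::field"
  assumes p: "p \<noteq> 0" and q: "q \<noteq> 0" and lam: "lam \<noteq> 0" and mu: "mu \<noteq> 0"
    and p_nonroot: "\<not> root_of_unity p" and q_nonroot: "\<not> root_of_unity q"
begin

lemma p_minus_1 [simp]: "p - 1 \<noteq> 0" "p \<noteq> 1"
  using p_nonroot by (auto simp: root_of_unity_def)

text \<open>The factor that arises from \<open>(z^b x^d s^k t^l) (z^b' x^d' s^k' t^l')\<close> when it is brought to normal
order by means of \<open>xz = p zx\<close>, \<open>sx = lam xs\<close>, \<open>tx = mu xt\<close>, \<open>ts = q^-1 st\<close> and the centrality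
of \<open>z\<close> with respect to \<open>s\<close> and \<open>t\<close>.\<close>

definition \<sigma> :: "expo \<Rightarrow> expo \<Rightarrow> 'k" where
  "\<sigma> u v = p powi (ex u * ez v) * lam powi (es u * ex v) * mu powi (et u * ex v) * inverse q powi (et u * es v)"

sublocale twisted_group_algebra \<sigma>
  by standard (auto simp: \<sigma>_def p q lam mu power_int_add distrib_left distrib_right)

notation tmult (infixl "\<star>" 70)

abbreviation M :: "expo \<Rightarrow> (expo \<Rightarrow>\<^sub>0 'k)" where "M u \<equiv> Poly_Mapping.single u 1"

abbreviation C :: "'k \<Rightarrow> (expo \<Rightarrow>\<^sub>0 'k)" where "C c \<equiv> Poly_Mapping.single 0 c"

text \<open>The element \<open>(z - 1) x^-1 / (p - 1)\<close>, which is \<open>y\<close> because \<open>yx = (z - 1) / (p - 1)\<close>.\<close>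

definition Y :: "expo \<Rightarrow>\<^sub>0 'k" where
  "Y = Poly_Mapping.single (eZ - eX) (inverse (p - 1)) - Poly_Mapping.single (- eX) (inverse (p - 1))"

section \<open>The homomorphism from the free algebra\<close>

fun img :: "generator \<Rightarrow> (expo \<Rightarrow>\<^sub>0 'k)" where
  "img Gx = M eX" | "img Gy = Y" | "img Gs = M eS" | "img Gt = M eT"

fun ev_word :: "generator list \<Rightarrow> (expo \<Rightarrow>\<^sub>0 'k)" where
  "ev_word [] = 1" | "ev_word (g # w) = img g \<star> ev_word w"

definition ev :: "('k, generator) free_alg \<Rightarrow> (expo \<Rightarrow>\<^sub>0 'k)" where
  "ev f = (\<Sum>w\<in>Poly_Mapping.keys f. C (Poly_Mapping.lookup f w) \<star> ev_word (letters w))"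

lemma ev_word_append: "ev_word (v @ w) = ev_word v \<star> ev_word w"
  by (induction v) (simp_all add: tmult_assoc)

lemma ev_superset:
  assumes "finite W" "Poly_Mapping.keys f \<subseteq> W"
  shows "ev f = (\<Sum>w\<in>W. C (Poly_Mapping.lookup f w) \<star> ev_word (letters w))"
  unfolding ev_def using assms by (intro sum.mono_neutral_left) (auto simp: in_keys_iff)

lemma ev_add: "ev (f + g) = ev f + ev g"
proof -
  let ?W = "Poly_Mapping.keys f \<union> Poly_Mapping.keys g"
  have "finite ?W" "Poly_Mapping.keys (f + g) \<subseteq> ?W"
    "Poly_Mapping.keys f \<subseteq> ?W" "Poly_Mapping.keys g \<subseteq> ?W"
    using Poly_Mapping.keys_add[of f g] by auto
  then show ?thesis
    by (simp add: ev_superset[of ?W] lookup_add single_add tmult_add_left sum.distrib)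
qed

lemma ev_zero [simp]: "ev 0 = 0"
  by (simp add: ev_def)

lemma ev_minus: "ev (- f) = - ev f"
  using ev_add[of "- f" f] by (simp add: eq_neg_iff_add_eq_0)

lemma ev_diff: "ev (f - g) = ev f - ev g"
  using ev_add[of f "- g"] by (simp add: ev_minus)

lemma ev_sum: "ev (\<Sum>i\<in>I. f i) = (\<Sum>i\<in>I. ev (f i))"
  by (induction I rule: infinite_finite_induct) (simp_all add: ev_add)

lemma ev_single: "ev (Poly_Mapping.single w c) = C c \<star> ev_word (letters w)"
  by (subst ev_superset[of "{w}"]) auto

lemma ev_mult: "ev (f * g) = ev f \<star> ev g"
proof (induction f rule: poly_mapping_linear_induct)
  case (single v a)
  show ?case
    by (induction g rule: poly_mapping_linear_induct)
      (simp_all add: mult_single ev_single ev_add tmult_add_right distrib_left plus_free_monoid_def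
        ev_word_append scalar_tmult_scalar)
qed (simp_all add: ev_add tmult_add_left distrib_right)

lemma ev_gen [simp]: "ev (gen g) = img g"
  by (simp add: gen_def ev_single)

lemma ev_scalar [simp]: "ev (scalar c) = C c"
  by (simp add: scalar_def ev_single zero_free_monoid_def)

lemma ev_one [simp]: "ev 1 = 1"
  using ev_scalar[of 1] by (simp add: scalar_def)

end

section \<open>Faithfulness of the model\<close>

lemma scalar_mult_commute: "f * scalar c = scalar c * f"
  by (induction f rule: poly_mapping_linear_induct)
    (simp_all add: scalar_def distrib_left distrib_right mult_single mult.commute)

lemma scalar_mult_scalar: "scalar a * scalar b = scalar (a * b)"
  by (simp add: scalar_def mult_single)

lemma scalar_one [simp]: "scalar 1 = 1"
  by (simp add: scalar_def)

lemma scalar_zero [simp]: "scalar 0 = 0"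
  by (simp add: scalar_def)

lemma scalar_add: "scalar (a + b) = scalar a + scalar b"
  by (simp add: scalar_def single_add)

lemma scalar_left_commute: "f * (scalar c * g) = scalar c * (f * g)"
  by (metis mult.assoc scalar_mult_commute)

interpretation free_alg: vector_space "\<lambda>(c::'k::field) (f::('k, 'g) free_alg). scalar c * f"
  by standard (simp_all add: distrib_left distrib_right mult.assoc[symmetric] scalar_mult_scalar,
    simp add: scalar_def single_add distrib_right)

lemma free_alg_ring_simps:
  "carrier free_alg_ring = (UNIV :: ('k::field, 'g) free_alg set)"
  "a \<oplus>\<^bsub>free_alg_ring\<^esub> b = a + (b :: ('k, 'g) free_alg)"
  "a \<otimes>\<^bsub>free_alg_ring\<^esub> b = a * b"
  "\<zero>\<^bsub>free_alg_ring\<^esub> = (0 :: ('k, 'g) free_alg)"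
  by (simp_all add: ring_of_type_algebra_def)

lemma relation_ideal_closed:
  fixes R :: "('k::field, 'g) free_alg set"
  shows "0 \<in> relation_ideal R"
    and "a \<in> relation_ideal R \<Longrightarrow> b \<in> relation_ideal R \<Longrightarrow> a + b \<in> relation_ideal R"
    and "a \<in> relation_ideal R \<Longrightarrow> c * a \<in> relation_ideal R"
    and "a \<in> relation_ideal R \<Longrightarrow> a * c \<in> relation_ideal R"
    and "R \<subseteq> relation_ideal R"
proof -
  interpret ideal "relation_ideal R" "free_alg_ring :: ('k, 'g) free_alg ring"
    by (rule ideal_relation_ideal)
  show "0 \<in> relation_ideal R"
    using additive_subgroup.zero_closed[OF ideal.axioms(1)[OF ideal_relation_ideal[of R]]] by (simp add: free_alg_ring_simps)
  show "a \<in> relation_ideal R \<Longrightarrow> b \<in> relation_ideal R \<Longrightarrow> a + b \<in> relation_ideal R"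
    using additive_subgroup.a_closed[OF ideal.axioms(1)[OF ideal_relation_ideal[of R]]] by (simp add: free_alg_ring_simps)
  show "a \<in> relation_ideal R \<Longrightarrow> c * a \<in> relation_ideal R"
    using I_l_closed[of a c] by (simp add: free_alg_ring_simps)
  show "a \<in> relation_ideal R \<Longrightarrow> a * c \<in> relation_ideal R"
    using I_r_closed[of a c] by (simp add: free_alg_ring_simps)
  show "R \<subseteq> relation_ideal R"
    unfolding relation_ideal_def
    by (rule ring.genideal_self[OF ring_free_alg]) (simp add: free_alg_ring_simps)
qed

lemma relation_ideal_minimal:
  fixes R :: "('k::field, 'g) free_alg set"
  assumes "R \<subseteq> J" "0 \<in> J" "\<And>a b. a \<in> J \<Longrightarrow> b \<in> J \<Longrightarrow> a + b \<in> J"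
    "\<And>a c. a \<in> J \<Longrightarrow> c * a \<in> J" "\<And>a c. a \<in> J \<Longrightarrow> a * c \<in> J"
  shows "relation_ideal R \<subseteq> J"
proof -
  interpret ring "free_alg_ring :: ('k, 'g) free_alg ring" by (rule ring_free_alg)
  have inv: "\<ominus>\<^bsub>free_alg_ring\<^esub> a = - a" for a :: "('k, 'g) free_alg"
    using minus_equality[of "- a" a] by (simp add: free_alg_ring_simps)
  have "- a \<in> J" if "a \<in> J" for a
    using assms(4)[OF that, of "- 1"] by simp
  then have "ideal J free_alg_ring"
    using assms inv by (intro idealI ring_free_alg add.subgroupI) (auto simp: free_alg_ring_simps)
  then show ?thesis
    unfolding relation_ideal_def using assms(1) by (rule genideal_minimal)
qed

context alg_parameters
begin

abbreviation "R \<equiv> relators p lam mu q"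
abbreviation "I \<equiv> relation_ideal R"

lemma ev_relator: "r \<in> R \<Longrightarrow> ev r = 0"
proof -
  have "p * inverse (p - 1) - inverse (p - 1) = 1"
    using right_inverse[OF p_minus_1(1)] by (simp only: left_diff_distrib mult_1_left)
  then have [simp]: "C (p * inverse (p - 1)) - C (inverse (p - 1)) = 1"
    by (simp flip: single_diff)
  assume "r \<in> R"
  then show ?thesis
    by (auto simp: relators_def ev_diff ev_mult Y_def tmult_diff tmult_single \<sigma>_def)
      (simp_all add: q algebra_simps)
qed

lemma ev_ideal: "f \<in> I \<Longrightarrow> ev f = 0"
proof -
  have "I \<subseteq> {f. ev f = 0}"
    by (rule relation_ideal_minimal) (auto simp: ev_relator ev_add ev_mult)
  then show "f \<in> I \<Longrightarrow> ev f = 0" by blast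
qed

text \<open>The elements \<open>y^i x^j s^k t^l\<close> span the algebra modulo the relations, and their images in the quantum
torus have distinct leading exponents. So they form a basis, and the kernel of \<open>ev\<close> is no larger than
the ideal of relations.\<close>

definition ordered_monomial :: "nat \<times> nat \<times> nat \<times> nat \<Rightarrow> ('k, generator) free_alg" where
  "ordered_monomial = (\<lambda>(i, j, k, l). gen Gy ^ i * gen Gx ^ j * gen Gs ^ k * gen Gt ^ l)"

definition Span :: "('k, generator) free_alg set" where
  "Span = free_alg.span (range ordered_monomial \<union> I)"

lemma Span_monomial: "ordered_monomial n \<in> Span"
  unfolding Span_def by (intro free_alg.span_base) auto

lemma Span_scale: "f \<in> Span \<Longrightarrow> scalar c * f \<in> Span"
  unfolding Span_def by (rule free_alg.span_scale)

lemma Span_add: "f \<in> Span \<Longrightarrow> g \<in> Span \<Longrightarrow> f + g \<in> Span"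
  unfolding Span_def by (rule free_alg.span_add)

lemma Span_ideal: "f \<in> I \<Longrightarrow> f \<in> Span"
  unfolding Span_def by (intro free_alg.span_base) auto

lemma Span_cong: "f - g \<in> I \<Longrightarrow> g \<in> Span \<Longrightarrow> f \<in> Span"
  using Span_add[OF Span_ideal, of "f - g" g] by simp

definition congruent_mod :: "('k, generator) free_alg \<Rightarrow> ('k, generator) free_alg \<Rightarrow> bool"  (infix "\<asymp>" 50) where
  "f \<asymp> g \<longleftrightarrow> f - g \<in> I"

lemma cong_refl [simp]: "f \<asymp> f"
  by (simp add: congruent_mod_def relation_ideal_closed)

lemma cong_trans [trans]: "f \<asymp> g \<Longrightarrow> g \<asymp> h \<Longrightarrow> f \<asymp> h"
  using relation_ideal_closed(2)[of "f - g" R "g - h"] by (simp add: congruent_mod_def)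

lemma cong_sym: "f \<asymp> g \<Longrightarrow> g \<asymp> f"
  using relation_ideal_closed(3)[of "f - g" R "- 1"] by (simp add: congruent_mod_def)

lemma cong_add: "f \<asymp> g \<Longrightarrow> f' \<asymp> g' \<Longrightarrow> f + f' \<asymp> g + g'"
  using relation_ideal_closed(2)[of "f - g" R "f' - g'"] by (simp add: congruent_mod_def algebra_simps)

lemma cong_mult_left: "f \<asymp> g \<Longrightarrow> h * f \<asymp> h * g"
  using relation_ideal_closed(3)[of "f - g" R h] by (simp add: congruent_mod_def algebra_simps)

lemma cong_mult_right: "f \<asymp> g \<Longrightarrow> f * h \<asymp> g * h"
  using relation_ideal_closed(4)[of "f - g" R h] by (simp add: congruent_mod_def algebra_simps)

lemma cong_relations:
  "gen Gx * gen Gy \<asymp> scalar p * (gen Gy * gen Gx) + 1"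
  "gen Gs * gen Gx \<asymp> scalar lam * (gen Gx * gen Gs)"
  "gen Gs * gen Gy \<asymp> scalar (inverse lam) * (gen Gy * gen Gs)"
  "gen Gt * gen Gx \<asymp> scalar mu * (gen Gx * gen Gt)"
  "gen Gt * gen Gy \<asymp> scalar (inverse mu) * (gen Gy * gen Gt)"
  "gen Gs * gen Gt \<asymp> scalar q * (gen Gt * gen Gs)"
  using relation_ideal_closed(5)[of R]
  by (auto simp: congruent_mod_def relators_def mult.assoc diff_diff_eq)

lemma cong_ts: "gen Gt * gen Gs \<asymp> scalar (inverse q) * (gen Gs * gen Gt)"
  using cong_mult_left[OF cong_sym[OF cong_relations(6)], of "scalar (inverse q)"] q
  by (simp add: mult.assoc[symmetric] scalar_mult_scalar)

lemma cong_commute_power: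
  assumes "g * h \<asymp> scalar c * (h * g)"
  shows "g * h ^ n \<asymp> scalar (c ^ n) * (h ^ n * g)"
proof (induction n)
  case (Suc n)
  have "g * h ^ Suc n \<asymp> (scalar c * (h * g)) * h ^ n"
    using cong_mult_right[OF assms, of "h ^ n"] by (simp add: mult.assoc)
  also have "\<dots> = (scalar c * h) * (g * h ^ n)"
    by (simp add: mult.assoc)
  also have "\<dots> \<asymp> (scalar c * h) * (scalar (c ^ n) * (h ^ n * g))"
    by (rule cong_mult_left[OF Suc.IH])
  also have "\<dots> = scalar (c ^ Suc n) * (h ^ Suc n * g)"
    by (simp add: mult.assoc scalar_left_commute[of h])
  finally show ?case .
qed simp

lemma cong_x_y_power:
  "\<exists>c. gen Gx * gen Gy ^ Suc i \<asymp> scalar (p ^ Suc i) * (gen Gy ^ Suc i * gen Gx) + scalar c * gen Gy ^ i"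
proof (induction i)
  case 0
  show ?case using cong_relations(1) by (auto intro!: exI[of _ 1])
next
  case (Suc i)
  then obtain c where c: "gen Gx * gen Gy ^ Suc i \<asymp> scalar (p ^ Suc i) * (gen Gy ^ Suc i * gen Gx) + scalar c * gen Gy ^ i"
    by blast
  have "gen Gx * gen Gy ^ Suc (Suc i) \<asymp> (scalar p * (gen Gy * gen Gx) + 1) * gen Gy ^ Suc i"
    using cong_mult_right[OF cong_relations(1), of "gen Gy ^ Suc i"] by (simp add: mult.assoc)
  also have "\<dots> = scalar p * gen Gy * (gen Gx * gen Gy ^ Suc i) + gen Gy ^ Suc i"
    by (simp add: mult.assoc distrib_right)
  also have "\<dots> \<asymp> scalar p * gen Gy * (scalar (p ^ Suc i) * (gen Gy ^ Suc i * gen Gx) + scalar c * gen Gy ^ i)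
      + gen Gy ^ Suc i"
    by (intro cong_add cong_mult_left c cong_refl)
  also have "\<dots> = scalar (p ^ Suc (Suc i)) * (gen Gy ^ Suc (Suc i) * gen Gx) + scalar (p * c + 1) * gen Gy ^ Suc i"
    by (simp add: mult.assoc scalar_left_commute[of "gen Gy"] distrib_left
        distrib_right scalar_add)
  finally show ?case by blast
qed

lemma Span_gen_monomial: "gen g * ordered_monomial n \<in> Span"
proof -
  obtain i j k l where n: "n = (i, j, k, l)" by (cases n)
  let ?y = "gen Gy ^ i" and ?x = "gen Gx ^ j" and ?s = "gen Gs ^ k" and ?t = "gen Gt ^ l"
  have in_Span: "f \<in> Span" if "f \<asymp> scalar c * ordered_monomial m" for f c m
    using Span_cong[OF _ Span_scale[OF Span_monomial]] that unfolding congruent_mod_def .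
  show ?thesis
  proof (cases g)
    case Gy
    have "gen g * ordered_monomial n = ordered_monomial (Suc i, j, k, l)"
      by (simp add: n Gy ordered_monomial_def mult.assoc)
    then show ?thesis using Span_monomial by simp
  next
    case Gx
    show ?thesis
    proof (cases i)
      case 0
      have "gen g * ordered_monomial n = ordered_monomial (0, Suc j, k, l)"
        by (simp add: n Gx 0 ordered_monomial_def mult.assoc)
      then show ?thesis using Span_monomial by simp
    next
      case (Suc i')
      obtain c where c: "gen Gx * gen Gy ^ Suc i' \<asymp>
          scalar (p ^ Suc i') * (gen Gy ^ Suc i' * gen Gx) + scalar c * gen Gy ^ i'"
        using cong_x_y_power by blast
      have "gen g * ordered_monomial n = (gen Gx * gen Gy ^ Suc i') * (?x * ?s * ?t)"
        by (simp add: n Gx Suc ordered_monomial_def mult.assoc)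
      also have "\<dots> \<asymp> (scalar (p ^ Suc i') * (gen Gy ^ Suc i' * gen Gx) + scalar c * gen Gy ^ i') * (?x * ?s * ?t)"
        by (rule cong_mult_right[OF c])
      also have "\<dots> = scalar (p ^ Suc i') * ordered_monomial (Suc i', Suc j, k, l)
          + scalar c * ordered_monomial (i', j, k, l)"
        by (simp add: ordered_monomial_def mult.assoc distrib_right)
      finally show ?thesis
        unfolding congruent_mod_def by (rule Span_cong) (intro Span_add Span_scale Span_monomial)
    qed
  next
    case Gs
    have "gen g * ordered_monomial n = (gen Gs * ?y) * (?x * ?s * ?t)"
      by (simp add: n Gs ordered_monomial_def mult.assoc)
    also have "\<dots> \<asymp> (scalar (inverse lam ^ i) * (?y * gen Gs)) * (?x * ?s * ?t)"
      by (intro cong_mult_right cong_commute_power cong_relations)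
    also have "\<dots> = scalar (inverse lam ^ i) * ?y * ((gen Gs * ?x) * (?s * ?t))"
      by (simp add: mult.assoc)
    also have "\<dots> \<asymp> scalar (inverse lam ^ i) * ?y * ((scalar (lam ^ j) * (?x * gen Gs)) * (?s * ?t))"
      by (intro cong_mult_left cong_mult_right cong_commute_power cong_relations)
    also have "\<dots> = scalar (inverse lam ^ i * lam ^ j) * ordered_monomial (i, j, Suc k, l)"
      by (simp add: ordered_monomial_def mult.assoc scalar_left_commute[of "_ ^ _"])
    finally show ?thesis by (rule in_Span)
  next
    case Gt
    have "gen g * ordered_monomial n = (gen Gt * ?y) * (?x * ?s * ?t)"
      by (simp add: n Gt ordered_monomial_def mult.assoc)
    also have "\<dots> \<asymp> (scalar (inverse mu ^ i) * (?y * gen Gt)) * (?x * ?s * ?t)"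
      by (intro cong_mult_right cong_commute_power cong_relations)
    also have "\<dots> = scalar (inverse mu ^ i) * ?y * ((gen Gt * ?x) * (?s * ?t))"
      by (simp add: mult.assoc)
    also have "\<dots> \<asymp> scalar (inverse mu ^ i) * ?y * ((scalar (mu ^ j) * (?x * gen Gt)) * (?s * ?t))"
      by (intro cong_mult_left cong_mult_right cong_commute_power cong_relations)
    also have "\<dots> = scalar (inverse mu ^ i) * ?y * (scalar (mu ^ j) * ?x) * ((gen Gt * ?s) * ?t)"
      by (simp add: mult.assoc)
    also have "\<dots> \<asymp> scalar (inverse mu ^ i) * ?y * (scalar (mu ^ j) * ?x) * ((scalar (inverse q ^ k) * (?s * gen Gt)) * ?t)"
      by (intro cong_mult_left cong_mult_right cong_commute_power cong_ts)
    also have "\<dots> = scalar (inverse mu ^ i * mu ^ j * inverse q ^ k) * ordered_monomial (i, j, k, Suc l)"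
      by (simp add: ordered_monomial_def mult.assoc scalar_left_commute[of "_ ^ _"])
    finally show ?thesis by (rule in_Span)
  qed
qed

lemma Span_gen_mult: "f \<in> Span \<Longrightarrow> gen g * f \<in> Span"
proof -
  assume "f \<in> Span"
  moreover have "free_alg.subspace {f. gen g * f \<in> Span}"
    by (rule free_alg.subspaceI)
      (auto simp: distrib_left scalar_left_commute[of "gen g"] Span_add Span_scale Span_ideal relation_ideal_closed)
  moreover have "range ordered_monomial \<union> I \<subseteq> {f. gen g * f \<in> Span}"
    using Span_gen_monomial Span_ideal relation_ideal_closed(3) by blast
  ultimately show ?thesis
    using free_alg.span_minimal[of "range ordered_monomial \<union> I" "{f. gen g * f \<in> Span}"]
    unfolding Span_def by blast
qed

text \<open>Every word is obtained from the empty word by left multiplications with generators, and these preserve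
the span.\<close>

lemma Span_everything: "f \<in> Span"
proof (induction f rule: poly_mapping_linear_induct)
  case zero
  show ?case by (simp add: Span_ideal relation_ideal_closed)
next
  case (single w c)
  obtain gs where w: "w = Wrd gs" by (cases w)
  have "Poly_Mapping.single (Wrd gs) 1 \<in> Span"
  proof (induction gs)
    case Nil
    have "Poly_Mapping.single (Wrd []) 1 = ordered_monomial (0, 0, 0, 0)"
      by (simp add: ordered_monomial_def zero_free_monoid_def[symmetric])
    then show ?case using Span_monomial by simp
  next
    case (Cons g gs)
    have "Poly_Mapping.single (Wrd (g # gs)) 1 = gen g * (Poly_Mapping.single (Wrd gs) 1 :: ('k, generator) free_alg)"
      by (simp add: gen_def mult_single plus_free_monoid_def)
    then show ?case using Span_gen_mult[OF Cons.IH] by simp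
  qed
  from Span_scale[OF this, of c] show ?case
    by (simp add: w scalar_def mult_single)
qed (rule Span_add)

lemma top_exp_power:
  assumes "ev (gen g) \<noteq> 0"
  shows "ev (gen g ^ n) \<noteq> 0" "top_exp (ev (gen g ^ n)) = Expo (int n * ez (top_exp (img g))) (int n * ex (top_exp (img g)))
    (int n * es (top_exp (img g))) (int n * et (top_exp (img g)))"
proof (induction n)
  case (Suc n)
  { case 1 then show ?case using Suc(1) assms top_exp_tmult(2) by (simp add: ev_mult) }
  { case 2 then show ?case using Suc assms top_exp_tmult(1) by (simp add: ev_mult expo_eq_iff algebra_simps) }
qed (simp_all add: expo_eq_iff)

lemma top_exp_Y: "Y \<noteq> 0" "top_exp Y = eZ - eX"
proof -
  have "eZ - eX \<noteq> - eX" by (simp add: expo_eq_iff)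
  then have *: "eZ - eX \<in> Poly_Mapping.keys Y"
    by (simp add: in_keys_iff Y_def lookup_minus lookup_single when_def)
  then show "Y \<noteq> 0" by auto
  show "top_exp Y = eZ - eX"
    by (rule top_exp_eqI[OF *])
      (auto simp: in_keys_iff Y_def lookup_minus lookup_single when_def less_eq_expo_def less_expo_def split: if_splits)
qed

lemma top_exp_img:
  "img g \<noteq> 0" "top_exp (img Gx) = eX" "top_exp (img Gy) = eZ - eX" "top_exp (img Gs) = eS" "top_exp (img Gt) = eT"
proof -
  show "img g \<noteq> 0" by (cases g) (simp_all add: top_exp_Y(1) single_nonzero)
qed (simp_all add: top_exp_Y(2))

lemma top_exp_ordered_monomial:
  "ev (ordered_monomial (i, j, k, l)) \<noteq> 0"
  "top_exp (ev (ordered_monomial (i, j, k, l))) = Expo (int i) (int j - int i) (int k) (int l)"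
  using top_exp_power[of Gy i] top_exp_power[of Gx j] top_exp_power[of Gs k] top_exp_power[of Gt l] top_exp_img
  by (simp_all add: ordered_monomial_def ev_mult top_exp_tmult expo_eq_iff del: img.simps)

text \<open>In a linear combination of ordered monomials that vanishes in the quantum torus, the term whose leading
exponent is largest cannot be cancelled by any other.\<close>

lemma in_relation_ideal_if_ev_zero:
  assumes "ev f = 0"
  shows "f \<in> I"
proof -
  have "f \<in> free_alg.span (range ordered_monomial \<union> I)"
    using Span_everything unfolding Span_def .
  then obtain a b where f: "f = a + b" and a: "a \<in> free_alg.span (range ordered_monomial)"
    and b: "b \<in> free_alg.span I"
    unfolding free_alg.span_Un by auto
  have "free_alg.subspace I"
    by (rule free_alg.subspaceI) (auto simp: relation_ideal_closed)
  with b have b: "b \<in> I" using free_alg.span_minimal[of I I] by blast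
  obtain U r where U: "finite U" "U \<subseteq> range ordered_monomial" and a: "a = (\<Sum>u\<in>U. scalar (r u) * u)"
    using a unfolding free_alg.span_explicit by auto
  have "ev a = 0" using f assms ev_ideal[OF b] by (simp add: ev_add)
  then have sum: "(\<Sum>u\<in>U. C (r u) \<star> ev u) = 0"
    by (simp add: a ev_sum ev_mult)
  have inj: "u = v" if uv: "u \<in> U" "v \<in> U" "top_exp (ev u) = top_exp (ev v)" for u v
  proof -
    obtain i j k l i' j' k' l' where
      *: "u = ordered_monomial (i, j, k, l)" "v = ordered_monomial (i', j', k', l')"
      using uv U by (metis (no_types, opaque_lifting) imageE subsetD surj_pair)
    with uv(3) have "i = i' \<and> int j - int i = int j' - int i' \<and> k = k' \<and> l = l'"
      by (simp add: top_exp_ordered_monomial)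
    then have "i = i'" "j = j'" "k = k'" "l = l'" by auto
    with * show ?thesis by simp
  qed
  have "r u = 0" if "u \<in> U" for u
  proof (rule ccontr)
    assume "r u \<noteq> 0"
    define V where "V = {u \<in> U. r u \<noteq> 0}"
    have V: "finite V" "V \<noteq> {}" using U(1) that \<open>r u \<noteq> 0\<close> by (auto simp: V_def)
    define m where "m = Max ((\<lambda>u. top_exp (ev u)) ` V)"
    have "m \<in> (\<lambda>u. top_exp (ev u)) ` V" unfolding m_def using V by (intro Max_in) auto
    then obtain v where v: "v \<in> V" "m = top_exp (ev v)" by auto
    have le: "top_exp (ev u) \<le> m" if "u \<in> V" for u
      unfolding m_def using V that by simp
    have zero: "Poly_Mapping.lookup (C (r u) \<star> ev u) m = 0" if "u \<in> U - {v}" for u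
    proof (cases "u \<in> V")
      case True
      have "m \<notin> Poly_Mapping.keys (ev u)"
        using top_exp_ge[of m "ev u"] le[OF True] inj[of u v] v that by (force simp: V_def)
      then show ?thesis by (simp add: lookup_single_tmult in_keys_iff)
    qed (use that in \<open>simp add: V_def lookup_single_tmult\<close>)
    have "v \<in> U" using v by (simp add: V_def)
    have "0 = (\<Sum>u\<in>U. Poly_Mapping.lookup (C (r u) \<star> ev u) m)"
      using sum by (simp flip: lookup_sum)
    also have "\<dots> = Poly_Mapping.lookup (C (r v) \<star> ev v) m"
      using zero by (simp add: sum.remove[OF U(1) \<open>v \<in> U\<close>])
    finally have "Poly_Mapping.lookup (ev v) m = 0"
      using v by (simp add: lookup_single_tmult V_def)
    moreover have "ev v \<noteq> 0"
      using \<open>v \<in> U\<close> U(2) top_exp_ordered_monomial(1) by (metis (no_types, opaque_lifting) imageE subsetD surj_pair)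
    ultimately show False using top_exp_in[of "ev v"] v by (simp add: in_keys_iff)
  qed
  then have "a = 0" by (simp add: a)
  with f b show ?thesis by simp
qed

end

context alg_parameters
begin

section \<open>Constraints on the image in the quantum torus\<close>

definition model :: "(expo \<Rightarrow>\<^sub>0 'k) set" where
  "model = range ev"

text \<open>Words are extended on the right because the constraint on layer sums below is preserved by right
multiplication with the generators, but not by left multiplication with \<open>x\<close>.\<close>

lemma model_induct [consumes 1, case_names one mult add scale]:
  assumes "f \<in> model" and "P 1" and "\<And>f g. f \<in> model \<Longrightarrow> P f \<Longrightarrow> P (f \<star> img g)"
    and "\<And>f g. P f \<Longrightarrow> P g \<Longrightarrow> P (f + g)" and "\<And>f c. P f \<Longrightarrow> P (C c \<star> f)"
  shows "P f"
proof -
  have word: "P (ev_word gs) \<and> ev_word gs \<in> model" for gs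
  proof (induction gs rule: rev_induct)
    case Nil
    show ?case using assms(2) ev_one unfolding model_def by (metis ev_word.simps(1) rangeI)
  next
    case (snoc g gs)
    have eq: "ev_word (gs @ [g]) = ev_word gs \<star> img g" by (simp add: ev_word_append)
    obtain a where "ev_word gs = ev a" using snoc.IH by (auto simp: model_def)
    then have "ev_word (gs @ [g]) = ev (a * gen g)" by (simp add: eq ev_mult)
    then have "ev_word (gs @ [g]) \<in> model" by (metis model_def rangeI)
    with eq assms(3) snoc.IH show ?case by simp
  qed
  have "P (ev a)" for a
  proof (induction a rule: poly_mapping_linear_induct)
    case zero
    show ?case using assms(5)[of 1 0] assms(2) by simp
  next
    case (single w c)
    show ?case using word assms(5) by (simp add: ev_single)
  next
    case (add f g)
    then show ?case using assms(4) by (simp add: ev_add)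
  qed
  then show ?thesis using assms(1) by (auto simp: model_def)
qed

lemma model_closed:
  "1 \<in> model" "img g \<in> model" "0 \<in> model"
  "f \<in> model \<Longrightarrow> f' \<in> model \<Longrightarrow> f + f' \<in> model"
  "f \<in> model \<Longrightarrow> f' \<in> model \<Longrightarrow> f \<star> f' \<in> model"
  "C c \<in> model"
  by (auto simp: model_def ev_add[symmetric] ev_mult[symmetric])
    (metis ev_one ev_gen ev_zero ev_scalar rangeI)+

text \<open>The part of \<open>f\<close> of degrees \<open>d\<close>, \<open>k\<close>, \<open>l\<close> in \<open>x\<close>, \<open>s\<close>, \<open>t\<close> has as coefficient a Laurent polynomial in
\<open>z\<close>; the layer sum is the value of this polynomial at \<open>z = 1\<close>.\<close>


definition layer_sum :: "int \<Rightarrow> int \<Rightarrow> int \<Rightarrow> (expo \<Rightarrow>\<^sub>0 'k) \<Rightarrow> 'k" where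
  "layer_sum d k l f = (\<Sum>u\<in>Poly_Mapping.keys f. Poly_Mapping.lookup f u when ex u = d \<and> es u = k \<and> et u = l)"

lemma layer_sum_superset:
  assumes "finite U" "Poly_Mapping.keys f \<subseteq> U"
  shows "layer_sum d k l f = (\<Sum>u\<in>U. Poly_Mapping.lookup f u when ex u = d \<and> es u = k \<and> et u = l)"
  unfolding layer_sum_def using assms by (intro sum.mono_neutral_left) (auto simp: in_keys_iff when_def)

lemma layer_sum_add [simp]: "layer_sum d k l (f + g) = layer_sum d k l f + layer_sum d k l g"
proof -
  let ?U = "Poly_Mapping.keys f \<union> Poly_Mapping.keys g"
  have "finite ?U" "Poly_Mapping.keys (f + g) \<subseteq> ?U"
    "Poly_Mapping.keys f \<subseteq> ?U" "Poly_Mapping.keys g \<subseteq> ?U"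
    using Poly_Mapping.keys_add[of f g] by auto
  then show ?thesis
    by (simp add: layer_sum_superset[of ?U] lookup_add when_add_distrib sum.distrib)
qed

lemma layer_sum_zero [simp]: "layer_sum d k l 0 = 0"
  by (simp add: layer_sum_def)

lemma layer_sum_diff [simp]: "layer_sum d k l (f - g) = layer_sum d k l f - layer_sum d k l g"
  using layer_sum_add[of d k l "f - g" g] by simp

lemma layer_sum_single [simp]:
  "layer_sum d k l (Poly_Mapping.single u c) = (if ex u = d \<and> es u = k \<and> et u = l then c else 0)"
  by (subst layer_sum_superset[of "{u}"]) (auto simp: when_def)

lemma layer_sum_scale: "layer_sum d k l (C c \<star> f) = c * layer_sum d k l f"
  by (induction f rule: poly_mapping_linear_induct)
    (auto simp: tmult_single tmult_add_right distrib_left)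

lemma \<sigma>_M:
  "\<sigma> u eX = lam powi es u * mu powi et u" "\<sigma> u eS = inverse q powi et u" "\<sigma> u eT = 1"
  "\<sigma> u (eZ - eX) = p powi ex u * lam powi (- es u) * mu powi (- et u)"
  "\<sigma> u (- eX) = lam powi (- es u) * mu powi (- et u)"
  by (simp_all add: \<sigma>_def)

lemma layer_sum_x: "layer_sum d k l (f \<star> M eX) = lam powi k * mu powi l * layer_sum (d - 1) k l f"
  by (induction f rule: poly_mapping_linear_induct)
    (auto simp: tmult_single tmult_add_left distrib_left \<sigma>_M)

lemma layer_sum_s: "layer_sum d k l (f \<star> M eS) = inverse q powi l * layer_sum d (k - 1) l f"
  by (induction f rule: poly_mapping_linear_induct)
    (auto simp: tmult_single tmult_add_left distrib_left \<sigma>_M)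

lemma layer_sum_t: "layer_sum d k l (f \<star> M eT) = layer_sum d k (l - 1) f"
  by (induction f rule: poly_mapping_linear_induct)
    (auto simp: tmult_single tmult_add_left distrib_left \<sigma>_M)

text \<open>Right multiplication by \<open>y\<close> multiplies the polynomial at \<open>x^d\<close> by \<open>p^d z - 1\<close>, since
\<open>x^d (z - 1) = (p^d z - 1) x^d\<close>. At \<open>d = 0\<close> this introduces a zero at \<open>z = 1\<close>.\<close>

lemma layer_sum_y:
  "layer_sum d k l (f \<star> Y) =
    inverse (p - 1) * lam powi (- k) * mu powi (- l) * (p powi (d + 1) - 1) * layer_sum (d + 1) k l f"
  by (induction f rule: poly_mapping_linear_induct)
    (auto simp: Y_def tmult_diff tmult_single tmult_add_left algebra_simps \<sigma>_M)

lemma model_nonneg: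
  "f \<in> model \<Longrightarrow> u \<in> Poly_Mapping.keys f \<Longrightarrow> 0 \<le> ez u \<and> 0 \<le> es u \<and> 0 \<le> et u"
proof (induction f arbitrary: u rule: model_induct)
  case (mult f g)
  obtain v w where "v \<in> Poly_Mapping.keys f" "w \<in> Poly_Mapping.keys (img g)" "u = v + w"
    using keys_tmult_subset[OF mult.prems] by blast
  moreover have "0 \<le> ez w \<and> 0 \<le> es w \<and> 0 \<le> et w"
    using \<open>w \<in> _\<close> by (cases g) (auto simp: Y_def in_keys_iff lookup_minus lookup_single when_def split: if_splits)
  ultimately show ?case using mult.IH by (force simp: add_nonneg_nonneg)
next
  case (add f g)
  then show ?case using Poly_Mapping.keys_add[of f g] by blast
next
  case (scale f c)
  then show ?case by (auto simp: in_keys_iff lookup_single_tmult)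
qed simp

text \<open>A negative power of \<open>x\<close> can only be produced by \<open>y\<close>, and crossing from \<open>x^0\<close> to \<open>x^-1\<close> leaves
a factor \<open>z - 1\<close>. This keeps the algebra apart from the full quantum torus, in which \<open>x\<close> is
invertible.\<close>

lemma model_layer_sum: "f \<in> model \<Longrightarrow> d < 0 \<Longrightarrow> layer_sum d k l f = 0"
proof (induction f arbitrary: d k l rule: model_induct)
  case one
  then show ?case using layer_sum_single[of d k l 0 1] by simp
next
  case (mult f g)
  show ?case
  proof (cases g)
    case Gy
    then show ?thesis using mult by (cases "d + 1 = 0") (simp_all add: layer_sum_y)
  qed (use mult in \<open>simp_all add: layer_sum_x layer_sum_s layer_sum_t\<close>)
qed (simp_all add: layer_sum_scale)

section \<open>Normal elements\<close>

text \<open>The inclusion \<open>A u \<subseteq> u A\<close>, where \<open>A\<close> is the set \<open>model\<close>; automorphisms preserve it.\<close>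

definition normal :: "(expo \<Rightarrow>\<^sub>0 'k) \<Rightarrow> bool" where
  "normal u \<longleftrightarrow> (\<forall>g\<in>model. \<exists>g'\<in>model. g \<star> u = u \<star> g')"

lemma M_z: "M eZ = 1 + C (p - 1) \<star> (Y \<star> M eX)"
proof -
  have "C (p - 1) \<star> (Y \<star> M eX) = M eZ - M 0"
    by (simp add: Y_def tmult_diff tmult_single \<sigma>_def expo_eq_iff
        del: single_one)
  then show ?thesis by simp
qed

lemma M_in_model: "M eZ \<in> model" "M eX \<in> model" "M eS \<in> model" "M eT \<in> model" "Y \<in> model"
  unfolding M_z using model_closed(2)[of Gx] model_closed(2)[of Gs] model_closed(2)[of Gt] model_closed(2)[of Gy]
  by (auto intro!: model_closed)

text \<open>By conjugation of the monomials \<open>z\<close>, \<open>s\<close>, \<open>t\<close>, \<open>x\<close> all exponents of \<open>u\<close> have the same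
commutation factors with these four. Since \<open>p\<close> and \<open>q\<close> are not roots of unity, the factors determine
the exponent: that of \<open>z\<close> gives the degree in \<open>x\<close>, then those of \<open>s\<close> and \<open>t\<close> give the degrees
in \<open>t\<close> and \<open>s\<close>, and that of \<open>x\<close> the degree in \<open>z\<close>. So \<open>u\<close> is a monomial. Its degree \<open>d\<close> in
\<open>x\<close> vanishes, because conjugation of \<open>y\<close> by \<open>u\<close> turns \<open>z - 1\<close> into a multiple of \<open>p^-d z - 1\<close>,
whereas the coefficient of \<open>x^-1\<close> in an element of the algebra is divisible by \<open>z - 1\<close>.\<close>

lemma normal_imp_monomial:
  assumes u: "u \<in> model" "u \<noteq> 0" "normal u"
  obtains c i k l where "c \<noteq> 0" "u = Poly_Mapping.single (Expo (int i) 0 (int k) (int l)) c"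
proof -
  have conj: "\<exists>d. d \<noteq> 0 \<and> (\<forall>v\<in>Poly_Mapping.keys u. \<sigma> e v = d * \<sigma> v e)"
    if e: "M e \<in> model" for e
  proof -
    obtain g where g: "M e \<star> u = u \<star> g" using u(3) e unfolding normal_def by blast
    show ?thesis
      by (rule conjugate_monomial[OF one_neq_zero u(2) g]) auto
  qed
  have ratio: "\<sigma> e v * \<sigma> w e = \<sigma> e w * \<sigma> v e"
    if "M e \<in> model" "v \<in> Poly_Mapping.keys u" "w \<in> Poly_Mapping.keys u" for e v w
    using conj[OF that(1)] that(2,3) by (auto simp: algebra_simps)
  have q': "\<not> root_of_unity (inverse q)" "inverse q \<noteq> 0"
    using q_nonroot q by (auto simp: root_of_unity_def power_inverse)
  have unique: "v = w" if vw: "v \<in> Poly_Mapping.keys u" "w \<in> Poly_Mapping.keys u" for v w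
  proof -
    have "ex v = ex w"
      using ratio[OF M_in_model(1) vw] power_int_inject[OF p_nonroot p] by (simp add: \<sigma>_def)
    moreover from this have "et v = et w"
      using ratio[OF M_in_model(3) vw] power_int_inject[OF q'] lam by (simp add: \<sigma>_def)
    moreover from calculation have "es v = es w"
      using ratio[OF M_in_model(4) vw] power_int_inject[OF q'] mu by (simp add: \<sigma>_def)
    moreover from calculation have "ez v = ez w"
      using ratio[OF M_in_model(2) vw] power_int_inject[OF p_nonroot p] lam mu by (simp add: \<sigma>_def)
    ultimately show ?thesis by (simp add: expo_eq_iff)
  qed
  define v where "v = top_exp u"
  have v: "v \<in> Poly_Mapping.keys u" unfolding v_def by (rule top_exp_in[OF u(2)])
  define c where "c = Poly_Mapping.lookup u v"
  have c: "c \<noteq> 0" using v by (simp add: c_def in_keys_iff)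
  have u_eq: "u = Poly_Mapping.single v c"
    using unique[OF v] by (intro poly_mapping_eqI) (auto simp: c_def lookup_single when_def in_keys_iff)
  obtain y' where y': "y' \<in> model" "Y \<star> u = u \<star> y'"
    using u(3) M_in_model(5) by (auto simp: normal_def)
  \<comment> \<open>Conjugation by \<open>m_v\<close> multiplies \<open>m_e\<close> by \<open>r e\<close>.\<close>
  define r where "r e = \<sigma> e v / \<sigma> v e" for e
  have "u \<star> y' = u \<star> (Poly_Mapping.single (eZ - eX) (inverse (p - 1) * r (eZ - eX))
      - Poly_Mapping.single (- eX) (inverse (p - 1) * r (- eX)))"
    unfolding y'(2)[symmetric]
    by (simp add: u_eq Y_def tmult_diff tmult_single r_def bichar_nonzero algebra_simps)
  then have "y' = Poly_Mapping.single (eZ - eX) (inverse (p - 1) * r (eZ - eX))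
      - Poly_Mapping.single (- eX) (inverse (p - 1) * r (- eX))"
    by (rule tmult_left_cancel[OF u(2)])
  then have "r (eZ - eX) = r (- eX)"
    using model_layer_sum[OF y'(1), of "-1" 0 0] by simp
  then have "p powi ex v = 1"
    using bichar_nonzero[of v eZ] bichar_nonzero
    by (simp add: r_def diff_conv_add_uminus bichar_add_left bichar_add_right field_simps del: add_uminus_conv_diff)
     (simp add: \<sigma>_def)
  then have "ex v = 0" by (rule power_int_eq_1_imp[OF p_nonroot p])
  then have "v = Expo (int (nat (ez v))) 0 (int (nat (es v))) (int (nat (et v)))"
    using model_nonneg[OF u(1) v] by (simp add: expo_eq_iff)
  with u_eq c that show ?thesis by metis
qed

lemma normal_monomials:
  assumes "e \<in> {eZ, eS, eT}"
  shows "normal (M e)"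
proof -
  have "\<exists>g'\<in>model. f \<star> M e = M e \<star> g'" if "f \<in> model" for f
    using that
  proof (induction f rule: model_induct)
    case one
    show ?case using model_closed(1) by (metis one_tmult tmult_one)
  next
    case (mult f g)
    then obtain f' where f': "f' \<in> model" "f \<star> M e = M e \<star> f'" by blast
    have [simp]: "a * (inverse a * b) = b" if "a \<noteq> 0" for a b :: 'k
      using that by (simp flip: mult.assoc)
    have "\<exists>c\<in>{1, p, inverse p, lam, inverse lam, mu, inverse mu, q, inverse q}.
        img g \<star> M e = M e \<star> (C c \<star> img g)"
      using assms
      by (cases g)
       (auto simp: Y_def tmult_single tmult_diff \<sigma>_def p q lam mu algebra_simps)
    then obtain c where c: "img g \<star> M e = M e \<star> (C c \<star> img g)" by blast
    have "(f \<star> img g) \<star> M e = M e \<star> (f' \<star> (C c \<star> img g))"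
      using f'(2) by (simp add: tmult_assoc c) (simp flip: tmult_assoc)
    moreover have "f' \<star> (C c \<star> img g) \<in> model"
      by (intro model_closed f')
    ultimately show ?case by blast
  next
    case (add f g)
    then show ?case using model_closed(4) by (metis tmult_add_left tmult_add_right)
  next
    case (scale f c)
    then obtain f' where f': "f' \<in> model" "f \<star> M e = M e \<star> f'" by blast
    have "(C c \<star> f) \<star> M e = M e \<star> (C c \<star> f')"
      using f'(2) by (metis scalar_tmult_commute tmult_assoc)
    moreover have "C c \<star> f' \<in> model" by (intro model_closed f')
    ultimately show ?case by blast
  qed
  then show ?thesis by (simp add: normal_def)
qed

end

section \<open>Automorphisms\<close>

lemma sum_of_nonneg_products_eq_1:
  fixes i k l a b c :: int
  assumes "i * a + k * b + l * c = 1" "0 \<le> i" "0 \<le> k" "0 \<le> l" "0 \<le> a" "0 \<le> b" "0 \<le> c"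
  shows "i = 1 \<and> a = 1 \<or> k = 1 \<and> b = 1 \<or> l = 1 \<and> c = 1"
proof -
  have "0 \<le> i * a" "0 \<le> k * b" "0 \<le> l * c" using assms by simp_all
  with assms(1) have "i * a = 1 \<or> k * b = 1 \<or> l * c = 1" by linarith
  then show ?thesis using assms by (auto simp: zmult_eq_1_iff)
qed

lemma sum_of_nonneg_products_eq_0:
  fixes i k l a b c :: int
  assumes "i * a + k * b + l * c = 0" "0 \<le> i" "0 \<le> k" "0 \<le> l" "0 \<le> a" "0 \<le> b" "0 \<le> c"
  shows "i * a = 0 \<and> k * b = 0 \<and> l * c = 0"
proof -
  have "0 \<le> i * a" "0 \<le> k * b" "0 \<le> l * c" using assms by simp_all
  with assms(1) show ?thesis by linarith
qed

locale model_automorphism = alg_parameters p q lam mu for p q lam mu :: "'k::field" +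
  fixes \<psi> :: "(expo \<Rightarrow>\<^sub>0 'k) \<Rightarrow> (expo \<Rightarrow>\<^sub>0 'k)"
  assumes bij: "bij_betw \<psi> model model"
    and hom_add: "f \<in> model \<Longrightarrow> g \<in> model \<Longrightarrow> \<psi> (f + g) = \<psi> f + \<psi> g"
    and hom_mult: "f \<in> model \<Longrightarrow> g \<in> model \<Longrightarrow> \<psi> (f \<star> g) = \<psi> f \<star> \<psi> g"
    and hom_scale: "f \<in> model \<Longrightarrow> \<psi> (C c \<star> f) = C c \<star> \<psi> f"
    and hom_one: "\<psi> 1 = 1"
begin

lemma closed: "f \<in> model \<Longrightarrow> \<psi> f \<in> model"
  using bij by (auto simp: bij_betw_def)

lemma surj: "g \<in> model \<Longrightarrow> \<exists>f\<in>model. \<psi> f = g"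
  using bij unfolding bij_betw_def by (metis imageE)

lemma inj: "f \<in> model \<Longrightarrow> g \<in> model \<Longrightarrow> \<psi> f = \<psi> g \<Longrightarrow> f = g"
  using bij by (auto simp: bij_betw_def inj_on_def)

lemma hom_zero: "\<psi> 0 = 0"
  using hom_scale[OF model_closed(1), of 0] by simp

lemma nonzero: "f \<in> model \<Longrightarrow> f \<noteq> 0 \<Longrightarrow> \<psi> f \<noteq> 0"
  using inj[of f 0] model_closed(3) hom_zero by auto

lemma normal_iff_normal_image:
  assumes "u \<in> model"
  shows "normal (\<psi> u) \<longleftrightarrow> normal u"
proof
  assume n: "normal u"
  show "normal (\<psi> u)"
    unfolding normal_def
  proof
    fix g assume "g \<in> model"
    then obtain h where h: "h \<in> model" "g = \<psi> h" using surj by metis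
    then obtain h' where h': "h' \<in> model" "h \<star> u = u \<star> h'" using n by (auto simp: normal_def)
    have "g \<star> \<psi> u = \<psi> u \<star> \<psi> h'"
      using h h' assms by (metis hom_mult)
    then show "\<exists>g'\<in>model. g \<star> \<psi> u = \<psi> u \<star> g'" using closed h' by blast
  qed
next
  assume n: "normal (\<psi> u)"
  show "normal u"
    unfolding normal_def
  proof
    fix g assume g: "g \<in> model"
    then obtain h where h: "h \<in> model" "\<psi> g \<star> \<psi> u = \<psi> u \<star> h" using n closed by (auto simp: normal_def)
    then obtain g' where g': "g' \<in> model" "h = \<psi> g'" using surj by metis
    have "\<psi> (g \<star> u) = \<psi> (u \<star> g')" using h g g' assms by (simp add: hom_mult)
    then have "g \<star> u = u \<star> g'" using inj model_closed(5) g g' assms by blast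
    then show "\<exists>g'\<in>model. g \<star> u = u \<star> g'" using g' by blast
  qed
qed

text \<open>The exponent of the monomial to which \<open>\<psi>\<close> sends \<open>z\<close>, \<open>s\<close> or \<open>t\<close>, up to a scalar.\<close>

definition E :: "expo \<Rightarrow> expo" where "E e = top_exp (\<psi> (M e))"

lemma normal_generator_in_model: "e \<in> {eZ, eS, eT} \<Longrightarrow> M e \<in> model"
  using M_in_model by auto

lemma image_of_normal_generator:
  assumes "e \<in> {eZ, eS, eT}"
  shows "\<exists>c. c \<noteq> 0 \<and> \<psi> (M e) = Poly_Mapping.single (E e) c"
    and "ex (E e) = 0" "0 \<le> ez (E e)" "0 \<le> es (E e)" "0 \<le> et (E e)"
proof -
  note e = normal_generator_in_model[OF assms]
  have "normal (\<psi> (M e))" using normal_iff_normal_image[OF e] normal_monomials[OF assms] by simp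
  from normal_imp_monomial[OF closed[OF e] nonzero[OF e] this]
  obtain c i k l where c: "c \<noteq> 0" "\<psi> (M e) = Poly_Mapping.single (Expo (int i) 0 (int k) (int l)) c"
    by (metis single_nonzero one_neq_zero)
  then have "E e = Expo (int i) 0 (int k) (int l)" by (simp add: E_def)
  with c show "\<exists>c. c \<noteq> 0 \<and> \<psi> (M e) = Poly_Mapping.single (E e) c"
    "ex (E e) = 0" "0 \<le> ez (E e)" "0 \<le> es (E e)" "0 \<le> et (E e)" by auto
qed

lemma image_of_product:
  assumes f: "f \<in> model" "\<psi> f = Poly_Mapping.single u c" "c \<noteq> 0" and e: "e \<in> {eZ, eS, eT}"
  shows "\<exists>c'. c' \<noteq> 0 \<and> \<psi> (f \<star> M e) = Poly_Mapping.single (u + E e) c'"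
proof -
  obtain d where "d \<noteq> 0" "\<psi> (M e) = Poly_Mapping.single (E e) d"
    using image_of_normal_generator(1)[OF e] by blast
  then show ?thesis
    using f hom_mult[OF f(1) normal_generator_in_model[OF e]] bichar_nonzero
    by (intro exI[of _ "\<sigma> u (E e) * c * d"]) (simp add: tmult_single)
qed

lemma image_of_normal_monomial:
  fixes i k l :: nat
  defines "m \<equiv> M (Expo (int i) 0 (int k) (int l))"
    and "w \<equiv> Expo (int i * ez (E eZ) + int k * ez (E eS) + int l * ez (E eT)) 0
      (int i * es (E eZ) + int k * es (E eS) + int l * es (E eT))
      (int i * et (E eZ) + int k * et (E eS) + int l * et (E eT))"
  shows "m \<in> model \<and> (\<exists>c. c \<noteq> 0 \<and> \<psi> m = Poly_Mapping.single w c)"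
  unfolding m_def w_def
proof (induction l)
  case 0
  show ?case
  proof (induction k)
    case 0
    show ?case
    proof (induction i)
      case 0
      have "Expo 0 0 0 0 = 0" by (simp add: zero_expo_def)
      then show ?case using model_closed(1) hom_one by (auto intro!: exI[of _ 1])
    next
      case (Suc i)
      have eq: "M (Expo (int (Suc i)) 0 (int 0) (int 0)) = M (Expo (int i) 0 (int 0) (int 0)) \<star> M eZ"
        by (simp add: tmult_single \<sigma>_def plus_expo_def add.commute)
      obtain c where c: "c \<noteq> 0" "\<psi> (M (Expo (int i) 0 (int 0) (int 0))) = Poly_Mapping.single
          (Expo (int i * ez (E eZ) + int 0 * ez (E eS) + int 0 * ez (E eT)) 0
            (int i * es (E eZ) + int 0 * es (E eS) + int 0 * es (E eT))
            (int i * et (E eZ) + int 0 * et (E eS) + int 0 * et (E eT))) c"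
        using Suc.IH by blast
      show ?case unfolding eq using image_of_product[OF conjunct1[OF Suc.IH] c(2,1), of eZ]
          model_closed(5)[OF conjunct1[OF Suc.IH] M_in_model(1)] image_of_normal_generator(2)[of eZ]
        by (simp add: plus_expo_def distrib_right add.commute)
    qed
  next
    case (Suc k)
    have eq: "M (Expo (int i) 0 (int (Suc k)) (int 0)) = M (Expo (int i) 0 (int k) (int 0)) \<star> M eS"
      by (simp add: tmult_single \<sigma>_def plus_expo_def add.commute)
    obtain c where c: "c \<noteq> 0" "\<psi> (M (Expo (int i) 0 (int k) (int 0))) = Poly_Mapping.single
        (Expo (int i * ez (E eZ) + int k * ez (E eS) + int 0 * ez (E eT)) 0
          (int i * es (E eZ) + int k * es (E eS) + int 0 * es (E eT))
          (int i * et (E eZ) + int k * et (E eS) + int 0 * et (E eT))) c"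
      using Suc.IH by blast
    show ?case unfolding eq using image_of_product[OF conjunct1[OF Suc.IH] c(2,1), of eS]
        model_closed(5)[OF conjunct1[OF Suc.IH] M_in_model(3)] image_of_normal_generator(2)[of eS]
      by (simp add: plus_expo_def distrib_right add_ac)
  qed
next
  case (Suc l)
  have eq: "M (Expo (int i) 0 (int k) (int (Suc l))) = M (Expo (int i) 0 (int k) (int l)) \<star> M eT"
    by (simp add: tmult_single \<sigma>_def plus_expo_def add.commute)
  obtain c where c: "c \<noteq> 0" "\<psi> (M (Expo (int i) 0 (int k) (int l))) = Poly_Mapping.single
      (Expo (int i * ez (E eZ) + int k * ez (E eS) + int l * ez (E eT)) 0
        (int i * es (E eZ) + int k * es (E eS) + int l * es (E eT))
        (int i * et (E eZ) + int k * et (E eS) + int l * et (E eT))) c"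
    using Suc.IH by blast
  show ?case unfolding eq using image_of_product[OF conjunct1[OF Suc.IH] c(2,1), of eT]
      model_closed(5)[OF conjunct1[OF Suc.IH] M_in_model(4)] image_of_normal_generator(2)[of eT]
    by (simp add: plus_expo_def distrib_right add_ac)
qed

text \<open>The preimage of the normal element \<open>m_e\<close> is again normal, so \<open>e\<close> is a combination of the three
exponents \<open>E eZ\<close>, \<open>E eS\<close>, \<open>E eT\<close> with coefficients in the natural numbers. A unit vector is
irreducible in the monoid of vectors of natural numbers, so it is one of the three.\<close>

lemma normal_generators_permuted:
  assumes e: "e \<in> {eZ, eS, eT}"
  shows "e \<in> {E eZ, E eS, E eT}"
proof -
  obtain w where w: "w \<in> model" "\<psi> w = M e"
    using surj[OF normal_generator_in_model[OF e]] by blast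
  have "w \<noteq> 0" using w(2) hom_zero single_nonzero[of "1 :: 'k" e] by auto
  moreover have "normal w" using normal_iff_normal_image[OF w(1)] w(2) normal_monomials[OF e] by simp
  ultimately obtain c i k l where c: "c \<noteq> 0" "w = Poly_Mapping.single (Expo (int i) 0 (int k) (int l)) c"
    using normal_imp_monomial[OF w(1)] by metis
  let ?m = "M (Expo (int i) 0 (int k) (int l))"
  let ?v = "Expo (int i * ez (E eZ) + int k * ez (E eS) + int l * ez (E eT)) 0
      (int i * es (E eZ) + int k * es (E eS) + int l * es (E eT))
      (int i * et (E eZ) + int k * et (E eS) + int l * et (E eT))"
  obtain d where m: "?m \<in> model" and d: "d \<noteq> 0" "\<psi> ?m = Poly_Mapping.single ?v d"
    using image_of_normal_monomial by metis
  have "w = C c \<star> ?m" by (simp add: c(2) tmult_single)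
  then have "M e = Poly_Mapping.single ?v (c * d)"
    using w(2) hom_scale[OF m] d(2) by (simp add: tmult_single)
  then have ev: "e = ?v"
    using top_bot_single(1)[of "c * d" ?v] top_bot_single(1)[of "1 :: 'k" e] c(1) d(1) by simp
  note nn = image_of_normal_generator(3-5)[of eZ] image_of_normal_generator(3-5)[of eS]
    image_of_normal_generator(3-5)[of eT]
  note one = sum_of_nonneg_products_eq_1[of "int i" _ "int k" _ "int l"]
    and zero = sum_of_nonneg_products_eq_0[of "int i" _ "int k" _ "int l"]
  note ex0 = image_of_normal_generator(2)[of eZ] image_of_normal_generator(2)[of eS]
    image_of_normal_generator(2)[of eT]
  consider "e = eZ" | "e = eS" | "e = eT" using e by blast
  then show ?thesis
  proof cases
    case 1
    then show ?thesis
      using ev one[of "ez (E eZ)" "ez (E eS)" "ez (E eT)"] zero[of "es (E eZ)" "es (E eS)" "es (E eT)"]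
        zero[of "et (E eZ)" "et (E eS)" "et (E eT)"] nn ex0 by (auto simp: expo_eq_iff)
  next
    case 2
    then show ?thesis
      using ev one[of "es (E eZ)" "es (E eS)" "es (E eT)"] zero[of "ez (E eZ)" "ez (E eS)" "ez (E eT)"]
        zero[of "et (E eZ)" "et (E eS)" "et (E eT)"] nn ex0 by (auto simp: expo_eq_iff)
  next
    case 3
    then show ?thesis
      using ev one[of "et (E eZ)" "et (E eS)" "et (E eT)"] zero[of "es (E eZ)" "es (E eS)" "es (E eT)"]
        zero[of "ez (E eZ)" "ez (E eS)" "ez (E eT)"] nn ex0 by (auto simp: expo_eq_iff)
  qed
qed

text \<open>The monomials \<open>z^b s^k t^l\<close> and \<open>z^b' s^k' t^l'\<close> commute up to the factor \<open>q^(k l' - l k')\<close>,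
and the images of \<open>s\<close> and \<open>t\<close> inherit the relation \<open>st = q ts\<close>. As \<open>q\<close> is not a root of
unity, the exponents of \<open>q\<close> can be compared.\<close>

lemma exponent_determinant: "es (E eS) * et (E eT) - et (E eS) * es (E eT) = 1"
proof -
  obtain b where b: "b \<noteq> 0" "\<psi> (M eS) = Poly_Mapping.single (E eS) b"
    using image_of_normal_generator(1)[of eS] by blast
  obtain c where c: "c \<noteq> 0" "\<psi> (M eT) = Poly_Mapping.single (E eT) c"
    using image_of_normal_generator(1)[of eT] by blast
  have "M eS \<star> M eT = C q \<star> (M eT \<star> M eS)"
    using q by (simp add: tmult_single \<sigma>_M) (simp add: \<sigma>_def add.commute)
  from arg_cong[OF this, of \<psi>] have "\<psi> (M eS) \<star> \<psi> (M eT) = C q \<star> (\<psi> (M eT) \<star> \<psi> (M eS))"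
    by (simp only: hom_mult hom_scale M_in_model model_closed(5))
  then have "Poly_Mapping.single (E eS + E eT) (\<sigma> (E eS) (E eT) * b * c) =
      Poly_Mapping.single (E eS + E eT) (q * (\<sigma> (E eT) (E eS) * c * b))"
    unfolding b c by (simp add: tmult_single add.commute)
  then have "\<sigma> (E eS) (E eT) * b * c = q * (\<sigma> (E eT) (E eS) * c * b)"
    by (metis lookup_single_eq)
  then have "\<sigma> (E eS) (E eT) = q * \<sigma> (E eT) (E eS)" using b(1) c(1) by simp
  then have "inverse q powi (et (E eS) * es (E eT)) = q * inverse q powi (et (E eT) * es (E eS))"
    using image_of_normal_generator(2)[of eS] image_of_normal_generator(2)[of eT]
    by (simp add: \<sigma>_def)
  also have "\<dots> = inverse q powi (et (E eT) * es (E eS) - 1)"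
    using q by (simp add: power_int_diff field_simps)
  finally have "et (E eS) * es (E eT) = et (E eT) * es (E eS) - 1"
    using q_nonroot q by (intro power_int_inject[of "inverse q"]) (auto simp: root_of_unity_def power_inverse)
  then show ?thesis by (simp add: mult.commute)
qed

lemma normal_generators_fixed: "E eZ = eZ" "E eS = eS" "E eT = eT"
proof -
  have "a = eZ \<and> b = eS \<and> c = eT"
    if "eZ \<in> {a, b, c}" "eS \<in> {a, b, c}" "eT \<in> {a, b, c}" "es b * et c - et b * es c = 1" for a b c
    using that by (simp only: insert_iff empty_iff) (elim disjE; (hypsubst | simp); simp)
  from this[OF normal_generators_permuted normal_generators_permuted normal_generators_permuted
      exponent_determinant]
  show "E eZ = eZ" "E eS = eS" "E eT = eT" by simp_all
qed

text \<open>Let \<open>X'\<close> and \<open>Y'\<close> be the images of \<open>x\<close> and \<open>y\<close>. As \<open>\<psi>\<close> fixes \<open>z\<close> up to a scalar \<open>\<zeta>\<close>,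
the relation \<open>xz = p zx\<close> forces \<open>X'\<close> to have degree 1 in \<open>x\<close>, and \<open>Y' X' = (\<zeta> z - 1) / (p - 1)\<close> has
the adjacent exponents \<open>z\<close> and \<open>1\<close>. So one factor is a monomial. It is not \<open>Y'\<close>, whose layer sums at \<open>x^-1\<close>
vanish. Hence \<open>X' = \<alpha> x\<close>, where further powers of \<open>z\<close>, \<open>s\<close> and \<open>t\<close> are excluded since their
inverses would occur in \<open>Y'\<close>. Finally \<open>Y'\<close> is a multiple of \<open>(\<zeta> z - 1) x^-1\<close>, so \<open>\<zeta> = 1\<close> by the
layer sum again.\<close>

lemma x_y_fixed:
  "\<exists>\<alpha>. \<alpha> \<noteq> 0 \<and> \<psi> (M eX) = C \<alpha> \<star> M eX \<and> \<psi> Y = C (inverse \<alpha>) \<star> Y"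
proof -
  define X' where "X' = \<psi> (M eX)"
  define Y' where "Y' = \<psi> Y"
  obtain \<zeta> where \<zeta>: "\<zeta> \<noteq> 0" "\<psi> (M eZ) = Poly_Mapping.single eZ \<zeta>"
    using image_of_normal_generator(1)[of eZ] normal_generators_fixed(1) by auto
  have X': "X' \<in> model" "X' \<noteq> 0" and Y': "Y' \<in> model" "Y' \<noteq> 0"
    using closed nonzero M_in_model top_exp_Y(1) single_nonzero[of "1::'k" eX] by (auto simp: X'_def Y'_def)
  let ?i = "inverse (p - 1)"
  have "Y \<star> M eX = C ?i \<star> M eZ + C (- ?i) \<star> 1"
    by (simp add: Y_def tmult_diff tmult_single \<sigma>_M single_uminus)
  then have "\<psi> (Y \<star> M eX) = C ?i \<star> \<psi> (M eZ) + C (- ?i) \<star> 1"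
    by (simp only: hom_add hom_scale hom_one M_in_model model_closed)
  then have YX: "Y' \<star> X' = Poly_Mapping.single eZ (?i * \<zeta>) + Poly_Mapping.single 0 (- ?i)"
    using \<zeta>(2) hom_mult[OF M_in_model(5,2)] by (simp add: X'_def Y'_def tmult_single)
  have top: "top_exp Y' + top_exp X' = eZ"
    unfolding top_exp_tmult(1)[OF Y'(2) X'(2), symmetric] YX using \<zeta>(1)
    by (intro top_exp_eqI) (auto simp: in_keys_iff lookup_add lookup_single when_def
        less_eq_expo_def less_expo_def zero_expo_def split: if_splits)
  have bot: "bot_exp Y' + bot_exp X' = 0"
    unfolding bot_exp_tmult[OF Y'(2) X'(2), symmetric] YX using \<zeta>(1)
    by (intro bot_exp_eqI) (auto simp: in_keys_iff lookup_add lookup_single when_def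
        less_eq_expo_def less_expo_def zero_expo_def split: if_splits)
  have exX: "ex u = 1" if u: "u \<in> Poly_Mapping.keys X'" for u
  proof -
    have "M eX \<star> M eZ = C p \<star> (M eZ \<star> M eX)"
      by (simp add: tmult_single \<sigma>_def add.commute)
    from arg_cong[OF this, of \<psi>] have "X' \<star> \<psi> (M eZ) = C p \<star> (\<psi> (M eZ) \<star> X')"
      by (simp only: X'_def hom_mult hom_scale M_in_model model_closed(5))
    then have "Poly_Mapping.lookup (X' \<star> \<psi> (M eZ)) (u + eZ) = Poly_Mapping.lookup (C p \<star> (\<psi> (M eZ) \<star> X')) (u + eZ)"
      by simp
    then have "p powi ex u = p powi 1"
      using u \<zeta>(1) by (simp add: \<zeta>(2) lookup_single_tmult lookup_tmult_single in_keys_iff) (simp add: \<sigma>_def)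
    then show ?thesis by (rule power_int_inject[OF p_nonroot p])
  qed
  have le: "bot_exp X' \<le> top_exp X'" "bot_exp Y' \<le> top_exp Y'"
    using top_exp_ge bot_exp_in X' Y' by blast+
  \<comment> \<open>The two nonnegative gaps between extreme exponents add up to the least positive exponent.\<close>
  have "top_exp X' = bot_exp X' \<or> top_exp Y' = bot_exp Y'"
  proof -
    have 1: "es (top_exp Y') + es (top_exp X') = 0" "et (top_exp Y') + et (top_exp X') = 0"
      "ex (top_exp Y') + ex (top_exp X') = 0" "ez (top_exp Y') + ez (top_exp X') = 1"
      "es (bot_exp Y') + es (bot_exp X') = 0" "et (bot_exp Y') + et (bot_exp X') = 0"
      "ex (bot_exp Y') + ex (bot_exp X') = 0" "ez (bot_exp Y') + ez (bot_exp X') = 0"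
      using top bot by (simp_all add: expo_eq_iff)
    show ?thesis using 1 le unfolding less_eq_expo_def less_expo_def expo_eq_iff by presburger
  qed
  moreover have "top_exp Y' \<noteq> bot_exp Y'"
  proof
    assume "top_exp Y' = bot_exp Y'"
    then have Y_mon: "Y' = Poly_Mapping.single (bot_exp Y') (Poly_Mapping.lookup Y' (bot_exp Y'))"
      using monomial_of_top_eq_bot Y' by blast
    have "ex (bot_exp X') = 1" using exX bot_exp_in X' by blast
    then have "ex (bot_exp Y') < 0" using bot by (simp add: expo_eq_iff)
    from model_layer_sum[OF Y'(1) this, of "es (bot_exp Y')" "et (bot_exp Y')"]
    have "Poly_Mapping.lookup Y' (bot_exp Y') = 0"
      by (subst (asm) (2) Y_mon) simp
    then show False using bot_exp_in[OF Y'(2)] by (simp add: in_keys_iff)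
  qed
  ultimately have "top_exp X' = bot_exp X'" by blast
  then have X_mon: "X' = Poly_Mapping.single (bot_exp X') (Poly_Mapping.lookup X' (bot_exp X'))"
    using monomial_of_top_eq_bot X' by blast
  define \<alpha> where "\<alpha> = Poly_Mapping.lookup X' (bot_exp X')"
  have \<alpha>: "\<alpha> \<noteq> 0" using bot_exp_in[OF X'(2)] by (simp add: \<alpha>_def in_keys_iff)
  have "bot_exp X' = eX"
    using bot exX[OF bot_exp_in[OF X'(2)]] model_nonneg[OF X'(1) bot_exp_in[OF X'(2)]]
      model_nonneg[OF Y'(1) bot_exp_in[OF Y'(2)]] by (simp add: expo_eq_iff)
  with X_mon have X_eq: "X' = Poly_Mapping.single eX \<alpha>" by (simp add: \<alpha>_def)
  have "(Poly_Mapping.single (eZ - eX) (?i * \<zeta> * inverse \<alpha>) - Poly_Mapping.single (- eX) (?i * inverse \<alpha>)) \<star> X' = Y' \<star> X'"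
    unfolding YX unfolding X_eq using \<alpha>
    by (simp add: tmult_diff tmult_single \<sigma>_M single_uminus mult.assoc)
  from this[symmetric] have Y_eq: "Y' = Poly_Mapping.single (eZ - eX) (?i * \<zeta> * inverse \<alpha>) - Poly_Mapping.single (- eX) (?i * inverse \<alpha>)"
    by (rule tmult_right_cancel[OF X'(2)])
  then have "\<zeta> = 1" using model_layer_sum[OF Y'(1), of "-1" 0 0] \<alpha> by simp
  then have "Y' = C (inverse \<alpha>) \<star> Y"
    by (simp add: Y_eq Y_def tmult_diff tmult_single mult.commute)
  moreover have "X' = C \<alpha> \<star> M eX" by (simp add: X_eq tmult_single)
  ultimately show ?thesis using \<alpha> by (auto simp: X'_def Y'_def)
qed

lemma s_t_fixed:
  "\<exists>\<beta>. \<beta> \<noteq> 0 \<and> \<psi> (M eS) = C \<beta> \<star> M eS" "\<exists>\<gamma>. \<gamma> \<noteq> 0 \<and> \<psi> (M eT) = C \<gamma> \<star> M eT"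
  using image_of_normal_generator(1)[of eS] image_of_normal_generator(1)[of eT]
  by (simp_all add: normal_generators_fixed tmult_single)

end

context alg_parameters
begin

lemma ev_eq_iff: "ev f = ev g \<longleftrightarrow> residue_class R f = residue_class R g"
proof -
  have "ev f = ev g \<longleftrightarrow> ev (f - g) = 0" by (simp add: ev_diff)
  then show ?thesis using ev_ideal in_relation_ideal_if_ev_zero by (auto simp only: residue_class_eq_iff)
qed

text \<open>Since the kernel of \<open>ev\<close> is the ideal of relations, \<open>ev\<close> identifies the presented algebra with
\<open>model\<close>, and \<open>\<psi>\<close> is \<open>\<phi>\<close> seen through this identification.\<close>

lemma automorphism_transfer:
  assumes "algebra_automorphism (alg_A p lam mu q) \<phi>"
  obtains \<psi> where "model_automorphism p q lam mu \<psi>"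
    and "\<And>f g. \<psi> (ev f) = ev g \<Longrightarrow> \<phi> (residue_class R f) = residue_class R g"
proof -
  let ?A = "presented_algebra R"
  have iso: "\<phi> \<in> ring_hom ?A ?A" "bij_betw \<phi> (carrier ?A) (carrier ?A)"
    and scale: "\<And>c a. a \<in> carrier ?A \<Longrightarrow> \<phi> (c \<odot>\<^bsub>?A\<^esub> a) = c \<odot>\<^bsub>?A\<^esub> \<phi> a"
    using assms by (auto simp: algebra_automorphism_def alg_A_def ring_iso_def)
  define lift where "lift f = (SOME g. \<phi> (residue_class R f) = residue_class R g)" for f
  have lift: "\<phi> (residue_class R f) = residue_class R (lift f)" for f
  proof -
    have "\<phi> (residue_class R f) \<in> carrier ?A"
      using iso(2) by (rule bij_betw_apply) (simp add: presented_algebra_simps)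
    then have "\<exists>g. \<phi> (residue_class R f) = residue_class R g"
      by (auto simp: presented_algebra_simps)
    then show ?thesis unfolding lift_def by (rule someI_ex)
  qed
  define \<psi> where "\<psi> u = ev (lift (SOME f. ev f = u))" for u
  have \<psi>: "\<psi> (ev f) = ev (lift f)" for f
  proof -
    have "ev (SOME g. ev g = ev f) = ev f" by (rule someI) simp
    then show ?thesis unfolding \<psi>_def ev_eq_iff by (metis lift)
  qed
  have \<psi>_iff: "\<psi> (ev f) = ev g \<longleftrightarrow> \<phi> (residue_class R f) = residue_class R g" for f g
    by (simp add: \<psi> ev_eq_iff lift)
  have "model_automorphism p q lam mu \<psi>"
  proof unfold_locales
    have "inj_on \<psi> model"
    proof (rule inj_onI)
      fix u v assume "u \<in> model" "v \<in> model" "\<psi> u = \<psi> v"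
      then obtain f g where fg: "u = ev f" "v = ev g" "\<phi> (residue_class R f) = \<phi> (residue_class R g)"
        by (auto simp: model_def \<psi> ev_eq_iff lift)
      then show "u = v"
        using iso(2) by (auto simp: bij_betw_def inj_on_def presented_algebra_simps ev_eq_iff)
    qed
    moreover have "\<psi> ` model = model"
    proof
      show "\<psi> ` model \<subseteq> model" by (auto simp: model_def \<psi>)
      show "model \<subseteq> \<psi> ` model"
      proof
        fix v assume "v \<in> model"
        then obtain g where g: "v = ev g" by (auto simp: model_def)
        have "residue_class R g \<in> \<phi> ` carrier ?A"
          using iso(2) by (auto simp: bij_betw_def presented_algebra_simps)
        then obtain f where "\<phi> (residue_class R f) = residue_class R g"
          by (auto simp: presented_algebra_simps)
        then have "\<psi> (ev f) = v" using \<psi>_iff g by simp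
        then show "v \<in> \<psi> ` model" by (auto simp: model_def)
      qed
    qed
    ultimately show "bij_betw \<psi> model model" by (simp add: bij_betw_def)
  next
    fix u v assume "u \<in> model" "v \<in> model"
    then obtain f g where fg: "u = ev f" "v = ev g" by (auto simp: model_def)
    have car: "residue_class R h \<in> carrier ?A" for h by (simp add: presented_algebra_simps)
    have "\<phi> (residue_class R (f + g)) = residue_class R (lift f + lift g)"
      using ring_hom_add[OF iso(1) car car, of f g] by (simp add: presented_algebra_simps lift)
    then show "\<psi> (u + v) = \<psi> u + \<psi> v"
      unfolding fg ev_add[symmetric] \<psi>[of f] \<psi>[of g] \<psi>_iff .
    have "\<phi> (residue_class R (f * g)) = residue_class R (lift f * lift g)"
      using ring_hom_mult[OF iso(1) car car, of f g] by (simp add: presented_algebra_simps lift)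
    then show "\<psi> (u \<star> v) = \<psi> u \<star> \<psi> v"
      unfolding fg ev_mult[symmetric] \<psi>[of f] \<psi>[of g] \<psi>_iff .
  next
    fix u c assume "u \<in> model"
    then obtain f where f: "u = ev f" by (auto simp: model_def)
    have car: "residue_class R h \<in> carrier ?A" for h by (simp add: presented_algebra_simps)
    have "\<phi> (residue_class R (scalar c * f)) = residue_class R (scalar c * lift f)"
      using scale[OF car, of c f] by (simp add: presented_algebra_simps lift)
    then show "\<psi> (C c \<star> u) = C c \<star> \<psi> u"
      unfolding f ev_scalar[symmetric] ev_mult[symmetric] \<psi>[of f] \<psi>_iff .
  next
    have "\<phi> (residue_class R 1) = residue_class R 1"
      using ring_hom_one[OF iso(1)] by (simp add: presented_algebra_simps)
    then show "\<psi> 1 = 1" using \<psi>_iff[of 1 1] by simp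
  qed
  with that \<psi>_iff show ?thesis by blast
qed

end

theorem theorem2p1:
  fixes p q lam mu :: "'k::field"
    and \<phi> :: "('k, generator) free_alg set \<Rightarrow> ('k, generator) free_alg set"
  defines "A \<equiv> alg_A p lam mu q"
    and "x \<equiv> A_gen p lam mu q Gx" and "y \<equiv> A_gen p lam mu q Gy"
    and "s \<equiv> A_gen p lam mu q Gs" and "t \<equiv> A_gen p lam mu q Gt"
  assumes "p \<noteq> 0" and "q \<noteq> 0" and "lam \<noteq> 0" and "mu \<noteq> 0"
    and "\<not> root_of_unity p" and "\<not> root_of_unity q"
    and "algebra_automorphism A \<phi>"
  shows "\<exists>\<alpha> \<beta> \<gamma>. \<alpha> \<noteq> 0 \<and> \<beta> \<noteq> 0 \<and> \<gamma> \<noteq> 0 \<and>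
    \<phi> x = \<alpha> \<odot>\<^bsub>A\<^esub> x \<and> \<phi> y = inverse \<alpha> \<odot>\<^bsub>A\<^esub> y \<and>
    \<phi> s = \<beta> \<odot>\<^bsub>A\<^esub> s \<and> \<phi> t = \<gamma> \<odot>\<^bsub>A\<^esub> t"
proof -
  interpret alg_parameters p q lam mu
    using assms by unfold_locales
  obtain \<psi> where "model_automorphism p q lam mu \<psi>"
    and \<psi>: "\<And>f g. \<psi> (ev f) = ev g \<Longrightarrow> \<phi> (residue_class R f) = residue_class R g"
    using automorphism_transfer assms(12) unfolding A_def by metis
  then interpret model_automorphism p q lam mu \<psi> by simp
  have scaled: "\<phi> (A_gen p lam mu q g) = c \<odot>\<^bsub>A\<^esub> A_gen p lam mu q g"
    if "\<psi> (img g) = C c \<star> img g" for g c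
    using \<psi>[of "gen g" "scalar c * gen g"] that
    by (simp add: ev_mult A_gen_def A_def alg_A_def presented_algebra_simps)
  obtain \<alpha> where "\<alpha> \<noteq> 0" "\<psi> (M eX) = C \<alpha> \<star> M eX" "\<psi> Y = C (inverse \<alpha>) \<star> Y"
    using x_y_fixed by blast
  moreover obtain \<beta> where "\<beta> \<noteq> 0" "\<psi> (M eS) = C \<beta> \<star> M eS"
    using s_t_fixed(1) by blast
  moreover obtain \<gamma> where "\<gamma> \<noteq> 0" "\<psi> (M eT) = C \<gamma> \<star> M eT"
    using s_t_fixed(2) by blast
  ultimately show ?thesis
    using scaled[of Gx \<alpha>] scaled[of Gy "inverse \<alpha>"] scaled[of Gs \<beta>] scaled[of Gt \<gamma>]
    unfolding x_def y_def s_def t_def by auto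
qed

end
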